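(* Let typical elements of $\mathfrak s^*_\pm=\mathfrak g_1^*\times\mathfrak g_2^*\times\mathbb H^*$ be denoted by $(A_1,A_2,g_D)$. There are two Casimir functions on $\mathfrak s^*_\pm$, given by $$C_1=|g_D|^2,\qquad C_2=|A_1g_D+g_DA_2|^2 .$$ The left reduced space $M_\lambda$ is symplectomorphic to the coadjoint orbit in $\mathfrak s^*_+$ given by setting $C_1=1$ and $C_2=|\lambda|^2$, and the right reduced space $M_\rho$ is symplectomorphic to the coadjoint orbit in $\mathfrak s^*_-$ given by setting $C_1=1$ and $C_2=|\rho|^2$. In each case the elements $(A_1,A_2,g_D)$ of the orbit may be identified with the left-invariant variables $(R_1,R_2,g_L)$ for the left reduced space, and with the right-invariant variables $(L_1,L_2,g_R)$ for the right reduced space. These coadjoint orbits are diffeomorphic to $S^2\times\mathbb R^3\times S^3$ for $C_2\neq0$, and to $\mathbb R^3\times S^3$ for $C_2=0$.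
   Context: $\mathbb H$ is the algebra of real quaternions, identified with $\mathbb R^4$, with inner product $\langle p,q\rangle=\frac12(pq^\dagger+qp^\dagger)$ and norm $|p|^2=\langle p,p\rangle$. $G=S^3\subset\mathbb H$ is the group of unit quaternions, with Lie algebra $\mathfrak g=\mathrm{Im}\,\mathbb H$; all spaces are identified with their duals via the inner product. The phase space of the 2-body problem on the 3-sphere is $$M=\{(g_1,p_1,g_2,p_2)\in\mathbb H^4: g_1,g_2\in G,\ \langle p_1,g_1\rangle=\langle p_2,g_2\rangle=0\}\cong T^*(G_1\times G_2)$$ ($G_1,G_2$ copies of $G$) with the canonical symplectic form. Two copies $G_L$, $G_R$ of $G$ act on $M$: $l\in G_L$ by left multiplication of all four entries by $l$, and $r\in G_R$ by right multiplication of all four entries by $r^{-1}$. Both actions are free and proper. Put $$L_i=p_ig_i^{-1},\quad R_i=g_i^{-1}p_i\ (i=1,2),\quad g_L=g_1^{-1}g_2,\quad g_R=g_1g_2^{-1}.$$ The momentum maps are $J_L=L_1+L_2\in\mathfrak g_L^*$ and $J_R=R_1+R_2\in\mathfrak g_R^*$. The left reduced space $M_\lambda$ (resp. right reduced space $M_\rho$) is the symplectic reduced space of $M$ by $G_L$ at $J_L=\lambda$ (resp. by $G_R$ at $J_R=\rho$); equivalently the orbit-reduced space $J_L^{-1}(\mathcal O)/G_L$ with $\mathcal O$ the coadjoint orbit through $\lambda$ (resp. likewise for $\rho$). $S=(G_1\times G_2)\ltimes\mathbb H$ is the semidirect product for the representation $(a,b)\cdot q=aqb^{-1}$ of $G_1\times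 G_2$ on $\mathbb H$; it is a double cover of the special Euclidean group $SE(4)$. Its Lie algebra is $\mathfrak s$, and $\mathfrak s^*_\pm=\mathfrak g_1^*\times\mathfrak g_2^*\times\mathbb H^*$ denotes the dual with Lie–Poisson bracket (with $\nabla_1,\nabla_2,\nabla_3$ the gradients with respect to the three factors, $[a,b]=ab-ba$, and the convention $\dot f=\{H,f\}$) $$\{f,h\}=\pm\langle A_1,[\nabla_1f,\nabla_1h]\rangle\pm\langle A_2,[\nabla_2f,\nabla_2h]\rangle\pm\langle g_D,(\nabla_1f\nabla_3h-\nabla_3h\nabla_2f)-(\nabla_1h\nabla_3f-\nabla_3f\nabla_2h)\rangle .$$ *)

theory Defs
  imports "HOL-Analysis.Analysis"
begin

section \<open>Quaternions\<close>

text \<open>A quaternion is stored as its real part together with its imaginary part in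
  \<open>Im \<bbbH> = \<real>\<^sup>3\<close>; the product is Hamilton's, written with the dot and cross product.\<close>

datatype quat = Quat (qre: real) (qim: "real^3")

lemma quat_eq_iff: "p = q \<longleftrightarrow> qre p = qre q \<and> qim p = qim q"
  by (cases p; cases q) simp

instantiation quat :: ab_group_add
begin
definition "0 = Quat 0 0"
definition "p + q = Quat (qre p + qre q) (qim p + qim q)"
definition "p - q = Quat (qre p - qre q) (qim p - qim q)"
definition "- q = Quat (- qre q) (- qim q)"
instance
  by standard
    (simp_all add: zero_quat_def plus_quat_def minus_quat_def uminus_quat_def)
end

instantiation quat :: real_vector
begin
definition "c *\<^sub>R q = Quat (c * qre q) (c *\<^sub>R qim q)"
instance
  by standard (simp_all add: scaleR_quat_def plus_quat_def algebra_simps)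
end

instantiation quat :: real_inner
begin
definition "inner p q = qre p * qre q + qim p \<bullet> qim q"
definition "norm (q::quat) = sqrt (q \<bullet> q)"
definition "sgn (q::quat) = q /\<^sub>R norm q"
definition "dist p q = norm (p - q :: quat)"
definition "uniformity = (INF e\<in>{0 <..}. principal {(p::quat, q). dist p q < e})"
definition "open (U :: quat set) \<longleftrightarrow>
  (\<forall>x\<in>U. eventually (\<lambda>(x', y). x' = x \<longrightarrow> y \<in> U) uniformity)"
instance
proof
  fix p q r :: quat and a :: real
  show "sgn p = p /\<^sub>R norm p" by (rule sgn_quat_def)
  show "dist p q = norm (p - q)" by (rule dist_quat_def)
  show "uniformity = (INF e\<in>{0 <..}. principal {(x::quat, y). dist x y < e})"
    by (rule uniformity_quat_def)
  show "open U \<longleftrightarrow> (\<forall>x\<in>U. eventually (\<lambda>(x', y). x' = x \<longrightarrow> y \<in> U) uniformity)"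
    for U :: "quat set"
    by (rule open_quat_def)
  show "p \<bullet> q = q \<bullet> p" by (simp add: inner_quat_def inner_commute)
  show "(p + q) \<bullet> r = p \<bullet> r + q \<bullet> r"
    by (simp add: inner_quat_def plus_quat_def inner_add_left algebra_simps)
  show "(a *\<^sub>R p) \<bullet> q = a * (p \<bullet> q)"
    by (simp add: inner_quat_def scaleR_quat_def algebra_simps)
  show "0 \<le> p \<bullet> p" by (simp add: inner_quat_def)
  show "p \<bullet> p = 0 \<longleftrightarrow> p = 0"
    by (simp add: inner_quat_def quat_eq_iff zero_quat_def add_nonneg_eq_0_iff)
  show "norm p = sqrt (p \<bullet> p)" by (rule norm_quat_def)
qed
end

instantiation quat :: euclidean_space
begin
definition "Basis = insert (Quat 1 0) (Quat 0 ` Basis)"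
instance
proof
  show "(Basis :: quat set) \<noteq> {}" "finite (Basis :: quat set)"
    by (simp_all add: Basis_quat_def)
  show "u \<bullet> v = (if u = v then 1 else 0)" if "u \<in> Basis" "v \<in> Basis" for u v :: quat
    using that by (auto simp: Basis_quat_def inner_quat_def inner_Basis split: if_splits)
  show "(\<forall>u\<in>Basis. q \<bullet> u = 0) \<longleftrightarrow> q = 0" for q :: quat
    by (auto simp: Basis_quat_def inner_quat_def quat_eq_iff zero_quat_def
        euclidean_all_zero_iff)
qed
end

definition cnj_quat :: "quat \<Rightarrow> quat"
  where "cnj_quat q = Quat (qre q) (- qim q)"

instantiation quat :: real_normed_div_algebra
begin
definition "1 = Quat 1 0"
definition "p * q = Quat (qre p * qre q - qim p \<bullet> qim q)
  (qre p *\<^sub>R qim q + qre q *\<^sub>R qim p + cross3 (qim p) (qim q))"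
definition "inverse q = cnj_quat q /\<^sub>R (q \<bullet> q)"
definition "p div q = p * inverse (q::quat)"

instance
proof
  fix p q r :: quat and a :: real
  note defs = times_quat_def plus_quat_def one_quat_def zero_quat_def scaleR_quat_def
    inner_quat_def
  show "p * q * r = p * (q * r)"
    unfolding quat_eq_iff vec_eq_iff forall_3
    by (simp add: defs cross_components inner_vec_def sum_3 algebra_simps)
  show "(p + q) * r = p * r + q * r" "p * (q + r) = p * q + p * r"
    "a *\<^sub>R p * q = a *\<^sub>R (p * q)" "p * a *\<^sub>R q = a *\<^sub>R (p * q)"
    unfolding quat_eq_iff vec_eq_iff forall_3
    by (simp_all add: defs cross_components inner_vec_def sum_3 algebra_simps)
  show "1 * p = p" "p * 1 = p" "(0::quat) \<noteq> 1"
    by (simp_all add: defs quat_eq_iff)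
  have cnj: "cnj_quat p * p = Quat (p \<bullet> p) 0" "p * cnj_quat p = Quat (p \<bullet> p) 0"
    unfolding quat_eq_iff vec_eq_iff forall_3
    by (simp_all add: defs cnj_quat_def cross_components inner_vec_def sum_3 algebra_simps)
  have scale: "c *\<^sub>R x * y = c *\<^sub>R (x * y)" "x * c *\<^sub>R y = c *\<^sub>R (x * y)"
    for c and x y :: quat
    unfolding quat_eq_iff vec_eq_iff forall_3
    by (simp_all add: defs cross_components inner_vec_def sum_3 algebra_simps)
  show "inverse p * p = 1" if "p \<noteq> 0"
    using that by (simp only: inverse_quat_def scale cnj) (simp add: scaleR_quat_def one_quat_def)
  show "p * inverse p = 1" if "p \<noteq> 0"
    using that by (simp only: inverse_quat_def scale cnj) (simp add: scaleR_quat_def one_quat_def)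
  show "p div q = p * inverse q" by (rule divide_quat_def)
  show "inverse 0 = (0::quat)"
    by (simp add: inverse_quat_def cnj_quat_def zero_quat_def scaleR_quat_def)
  have "(p * q) \<bullet> (p * q) = (p \<bullet> p) * (q \<bullet> q)"
    by (simp add: defs cross_components inner_vec_def sum_3 algebra_simps)
  then show "norm (p * q) = norm p * norm q"
    by (simp add: norm_quat_def real_sqrt_mult)
qed
end

lemma inner_quat_cnj:
  "of_real (p \<bullet> q) = (1/2) *\<^sub>R (p * cnj_quat q + q * cnj_quat p)"
  unfolding of_real_def quat_eq_iff vec_eq_iff forall_3
  by (simp add: times_quat_def plus_quat_def one_quat_def scaleR_quat_def inner_quat_def
      cnj_quat_def cross_components inner_vec_def sum_3 algebra_simps)

text \<open>The inclusion of the Lie algebra \<open>\<gg> = Im \<bbbH>\<close> of \<open>S\<^sup>3\<close>, modelled as \<open>\<real>\<^sup>3\<close>, in \<open>\<bbbH>\<close>.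
  It is isometric, and \<open>qim\<close> is its left inverse.\<close>

definition imq :: "real^3 \<Rightarrow> quat"
  where "imq v = Quat 0 v"

abbreviation S3 :: "quat set"
  where "S3 \<equiv> sphere 0 1"


section \<open>Smooth and symplectic spaces\<close>

primrec higher_differentiable_on ::
  "'a::real_normed_vector set \<Rightarrow> ('a \<Rightarrow> 'b::real_normed_vector) \<Rightarrow> nat \<Rightarrow> bool" where
  "higher_differentiable_on U f 0 \<longleftrightarrow> continuous_on U f"
| "higher_differentiable_on U f (Suc n) \<longleftrightarrow>
     (\<forall>x\<in>U. f differentiable (at x)) \<and>
     (\<forall>v. higher_differentiable_on U (\<lambda>x. frechet_derivative f (at x) v) n)"

text \<open>\<open>C\<^sup>\<infinity>\<close>; only used for open \<open>U\<close>.\<close>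

definition smooth_on :: "'a::real_normed_vector set \<Rightarrow> ('a \<Rightarrow> 'b::real_normed_vector) \<Rightarrow> bool"
  where "smooth_on U f \<longleftrightarrow> (\<forall>n. higher_differentiable_on U f n)"

text \<open>The smooth structure of a manifold is recorded by its algebra of smooth real functions.
  Functions are total in HOL, so \<open>funs\<close> consists of all total functions whose restriction to
  \<open>pts\<close> is smooth.\<close>

record 'a smooth_space =
  pts :: "'a set"
  funs :: "('a \<Rightarrow> real) set"

text \<open>Embedded submanifolds of Euclidean space: a function is smooth iff it locally extends to
  a smooth function on an open subset of the ambient space.\<close>

definition embedded :: "'a::euclidean_space set \<Rightarrow> 'a smooth_space" where
  "embedded X = \<lparr>pts = X,
     funs = {f. \<forall>x\<in>X. \<exists>U F. open U \<and> x \<in> U \<and> smooth_on U F \<and> (\<forall>y\<in>U \<inter> X. f y = F y)}\<rparr>"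

definition diffeo ::
  "('a, 'm) smooth_space_scheme \<Rightarrow> ('b, 'n) smooth_space_scheme \<Rightarrow> ('a \<Rightarrow> 'b) \<Rightarrow> bool" where
  "diffeo X Y \<phi> \<longleftrightarrow> bij_betw \<phi> (pts X) (pts Y) \<and>
     (\<forall>g\<in>funs Y. g \<circ> \<phi> \<in> funs X) \<and>
     (\<forall>f\<in>funs X. f \<circ> inv_into (pts X) \<phi> \<in> funs Y)"

definition diffeomorphic ::
  "('a, 'm) smooth_space_scheme \<Rightarrow> ('b, 'n) smooth_space_scheme \<Rightarrow> bool" where
  "diffeomorphic X Y \<longleftrightarrow> (\<exists>\<phi>. diffeo X Y \<phi>)"

text \<open>Tangent vectors are velocities of smooth curves.  A velocity is identified with the
  derivation \<open>f \<mapsto> (f \<circ> \<gamma>)'(0)\<close> that it induces on smooth functions, set to \<open>0\<close> on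
  non-smooth functions so that equal velocities are equal as HOL functions.\<close>

type_synonym 'a tvec = "('a \<Rightarrow> real) \<Rightarrow> real"

definition smooth_curve :: "('a, 'm) smooth_space_scheme \<Rightarrow> (real \<Rightarrow> 'a) \<Rightarrow> bool" where
  "smooth_curve X \<gamma> \<longleftrightarrow> (\<exists>e>0. (\<forall>t\<in>{-e<..<e}. \<gamma> t \<in> pts X) \<and>
     (\<forall>f\<in>funs X. smooth_on {-e<..<e} (f \<circ> \<gamma>)))"

definition velocity :: "('a, 'm) smooth_space_scheme \<Rightarrow> (real \<Rightarrow> 'a) \<Rightarrow> 'a tvec" where
  "velocity X \<gamma> = (\<lambda>f. if f \<in> funs X then deriv (f \<circ> \<gamma>) 0 else 0)"

definition tangent :: "('a, 'm) smooth_space_scheme \<Rightarrow> 'a \<Rightarrow> 'a tvec set" where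
  "tangent X x = {velocity X \<gamma> | \<gamma>. smooth_curve X \<gamma> \<and> \<gamma> 0 = x}"

text \<open>The tangent map of \<open>\<phi>\<close>, with codomain \<open>Y\<close>.\<close>

definition push :: "('b, 'n) smooth_space_scheme \<Rightarrow> ('a \<Rightarrow> 'b) \<Rightarrow> 'a tvec \<Rightarrow> 'b tvec" where
  "push Y \<phi> D = (\<lambda>g. if g \<in> funs Y then D (g \<circ> \<phi>) else 0)"

text \<open>For an embedded submanifold, the ambient vector given by a tangent vector: its
  coordinates are the derivatives of the coordinate functions.\<close>

definition ambient :: "'a::euclidean_space tvec \<Rightarrow> 'a" where
  "ambient D = (\<Sum>b\<in>Basis. D (\<lambda>x. x \<bullet> b) *\<^sub>R b)"

record 'a symp_space = "'a smooth_space" +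
  form :: "'a \<Rightarrow> 'a tvec \<Rightarrow> 'a tvec \<Rightarrow> real"

definition embedded_symp ::
  "'a::euclidean_space set \<Rightarrow> ('a \<Rightarrow> 'a \<Rightarrow> 'a \<Rightarrow> real) \<Rightarrow> 'a symp_space" where
  "embedded_symp X \<omega> = \<lparr>pts = X, funs = funs (embedded X),
     form = \<lambda>x D E. \<omega> x (ambient D) (ambient E)\<rparr>"

definition symplectomorphism :: "'a symp_space \<Rightarrow> 'b symp_space \<Rightarrow> ('a \<Rightarrow> 'b) \<Rightarrow> bool" where
  "symplectomorphism X Y \<phi> \<longleftrightarrow> diffeo X Y \<phi> \<and>
     (\<forall>x\<in>pts X. \<forall>D\<in>tangent X x. \<forall>E\<in>tangent X x.
        form Y (\<phi> x) (push Y \<phi> D) (push Y \<phi> E) = form X x D E)"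


section \<open>Symplectic reduction\<close>

definition action_orbit :: "'g set \<Rightarrow> ('g \<Rightarrow> 'a \<Rightarrow> 'a) \<Rightarrow> 'a \<Rightarrow> 'a set" where
  "action_orbit K act z = (\<lambda>k. act k z) ` K"

definition level_set :: "('a, 'm) smooth_space_scheme \<Rightarrow> ('a \<Rightarrow> 'b) \<Rightarrow> 'b \<Rightarrow> 'a set" where
  "level_set M J \<mu> = {z \<in> pts M. J z = \<mu>}"

definition isotropy :: "'g set \<Rightarrow> ('g \<Rightarrow> 'b \<Rightarrow> 'b) \<Rightarrow> 'b \<Rightarrow> 'g set" where
  "isotropy G coad \<mu> = {k \<in> G. coad k \<mu> = \<mu>}"

text \<open>The Marsden--Weinstein quotient \<open>J\<^sup>-\<^sup>1(\<mu>)/G\<^sub>\<mu>\<close>, whose points are the \<open>G\<^sub>\<mu>\<close>-orbits, with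
  projection \<open>\<pi>\<close>.  Functions \<open>f\<close> on it are smooth iff \<open>f \<circ> \<pi>\<close> is smooth on \<open>Z = J\<^sup>-\<^sup>1(\<mu>)\<close>, and the
  reduced form \<open>\<omega>\<^sub>\<mu>\<close> is determined by \<open>\<pi>\<^sup>* \<omega>\<^sub>\<mu> = \<iota>\<^sup>* \<omega>\<close> for the inclusion \<open>\<iota>\<close> of \<open>Z\<close> in \<open>M\<close>.\<close>

definition reduced_space ::
  "'a::euclidean_space symp_space \<Rightarrow> 'g set \<Rightarrow> ('g \<Rightarrow> 'a \<Rightarrow> 'a) \<Rightarrow>
   ('g \<Rightarrow> 'b \<Rightarrow> 'b) \<Rightarrow> ('a \<Rightarrow> 'b) \<Rightarrow> 'b \<Rightarrow> 'a set symp_space" where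
  "reduced_space M G act coad J \<mu> =
     (let Z = embedded (level_set M J \<mu>);
          \<pi> = action_orbit (isotropy G coad \<mu>) act;
          Q = \<lparr>pts = \<pi> ` pts Z, funs = {f. f \<circ> \<pi> \<in> funs Z}\<rparr>
      in \<lparr>pts = pts Q, funs = funs Q,
        form = \<lambda>c D E. THE r. \<exists>z\<in>pts Z. \<exists>D'\<in>tangent Z z. \<exists>E'\<in>tangent Z z.
           \<pi> z = c \<and> push Q \<pi> D' = D \<and> push Q \<pi> E' = E \<and>
           r = form M z (push M id D') (push M id E')\<rparr>)"


section \<open>The 2-body problem on the 3-sphere\<close>

text \<open>Points are tuples \<open>(g\<^sub>1, p\<^sub>1, g\<^sub>2, p\<^sub>2)\<close>.\<close>

type_synonym phase = "quat \<times> quat \<times> quat \<times> quat"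

definition phase_set :: "phase set" where
  "phase_set = {(g1, p1, g2, p2). g1 \<in> S3 \<and> g2 \<in> S3 \<and> p1 \<bullet> g1 = 0 \<and> p2 \<bullet> g2 = 0}"

text \<open>The tautological 1-form \<open>\<langle>p\<^sub>1, dg\<^sub>1\<rangle> + \<langle>p\<^sub>2, dg\<^sub>2\<rangle>\<close> of the cotangent bundle.\<close>

fun tautological :: "phase \<Rightarrow> phase \<Rightarrow> real" where
  "tautological (g1, p1, g2, p2) (v1, w1, v2, w2) = p1 \<bullet> v1 + p2 \<bullet> v2"

definition ext_deriv ::
  "('a::real_normed_vector \<Rightarrow> 'a \<Rightarrow> real) \<Rightarrow> 'a \<Rightarrow> 'a \<Rightarrow> 'a \<Rightarrow> real" where
  "ext_deriv \<theta> x u v = frechet_derivative (\<lambda>y. \<theta> y v) (at x) u -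
     frechet_derivative (\<lambda>y. \<theta> y u) (at x) v"

text \<open>The canonical symplectic form is taken to be \<open>d\<theta> = \<Sum> dp \<and> dg\<close>: this is the sign for which
  \<open>{f, h} = \<omega>(X\<^sub>f, X\<^sub>h)\<close> and \<open>X\<^sub>H = {H, \<cdot>}\<close> give Hamilton's equations, that is, the convention
  \<open>df/dt = {H, f}\<close>.  The forms on coadjoint orbits below obey the same rule.\<close>

definition phase_space :: "phase symp_space" where
  "phase_space = embedded_symp phase_set (ext_deriv tautological)"

fun left_act :: "quat \<Rightarrow> phase \<Rightarrow> phase" where
  "left_act l (g1, p1, g2, p2) = (l * g1, l * p1, l * g2, l * p2)"

fun right_act :: "quat \<Rightarrow> phase \<Rightarrow> phase" where
  "right_act r (g1, p1, g2, p2) =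
     (g1 * inverse r, p1 * inverse r, g2 * inverse r, p2 * inverse r)"

text \<open>The coadjoint action of \<open>S\<^sup>3\<close> on \<open>\<gg>\<^sup>* = \<gg>\<close>; it equals the adjoint one because the inner
  product is invariant.\<close>

definition coad3 :: "quat \<Rightarrow> quat \<Rightarrow> quat" where
  "coad3 k \<mu> = k * \<mu> * inverse k"

fun L1 :: "phase \<Rightarrow> quat" where "L1 (g1, p1, g2, p2) = p1 * inverse g1"
fun L2 :: "phase \<Rightarrow> quat" where "L2 (g1, p1, g2, p2) = p2 * inverse g2"
fun R1 :: "phase \<Rightarrow> quat" where "R1 (g1, p1, g2, p2) = inverse g1 * p1"
fun R2 :: "phase \<Rightarrow> quat" where "R2 (g1, p1, g2, p2) = inverse g2 * p2"
fun gL :: "phase \<Rightarrow> quat" where "gL (g1, p1, g2, p2) = inverse g1 * g2"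
fun gR :: "phase \<Rightarrow> quat" where "gR (g1, p1, g2, p2) = g1 * inverse g2"

definition JL :: "phase \<Rightarrow> quat" where "JL z = L1 z + L2 z"
definition JR :: "phase \<Rightarrow> quat" where "JR z = R1 z + R2 z"

definition left_reduced :: "quat \<Rightarrow> phase set symp_space" where
  "left_reduced \<mu> = reduced_space phase_space S3 left_act coad3 JL \<mu>"

definition right_reduced :: "quat \<Rightarrow> phase set symp_space" where
  "right_reduced \<mu> = reduced_space phase_space S3 right_act coad3 JR \<mu>"

definition left_proj :: "quat \<Rightarrow> phase \<Rightarrow> phase set" where
  "left_proj \<mu> = action_orbit (isotropy S3 coad3 \<mu>) left_act"

definition right_proj :: "quat \<Rightarrow> phase \<Rightarrow> phase set" where
  "right_proj \<mu> = action_orbit (isotropy S3 coad3 \<mu>) right_act"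


section \<open>The semidirect product and its coadjoint orbits\<close>

text \<open>The group \<open>S = (S\<^sup>3 \<times> S\<^sup>3) \<ltimes> \<bbbH>\<close>; the operations make sense for all nonzero \<open>a\<close>, \<open>b\<close>.\<close>

type_synonym sgroup = "quat \<times> quat \<times> quat"

definition S_carrier :: "sgroup set" where
  "S_carrier = S3 \<times> S3 \<times> UNIV"

fun S_mult :: "sgroup \<Rightarrow> sgroup \<Rightarrow> sgroup" where
  "S_mult (a, b, q) (a', b', q') = (a * a', b * b', q + a * q' * inverse b)"

definition S_one :: sgroup where
  "S_one = (1, 1, 0)"

fun S_inv :: "sgroup \<Rightarrow> sgroup" where
  "S_inv (a, b, q) = (inverse a, inverse b, - (inverse a * q * b))"

text \<open>The Lie algebra \<open>\<ss>\<close>.  Its dual is identified with it by the inner product, so the same type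
  serves for \<open>\<ss>\<^sup>*\<close>, with elements \<open>(A\<^sub>1, A\<^sub>2, g\<^sub>D)\<close>.\<close>

type_synonym salg = "(real^3) \<times> (real^3) \<times> quat"

fun salg_to_quat :: "salg \<Rightarrow> quat \<times> quat \<times> quat" where
  "salg_to_quat (x, y, u) = (imq x, imq y, u)"

fun quat_to_salg :: "quat \<times> quat \<times> quat \<Rightarrow> salg" where
  "quat_to_salg (a, b, q) = (qim a, qim b, q)"

text \<open>The adjoint action is the derivative of conjugation at the identity, computed in the
  ambient space \<open>\<bbbH> \<times> \<bbbH> \<times> \<bbbH>\<close> of \<open>S\<close>.\<close>

definition S_Ad :: "sgroup \<Rightarrow> salg \<Rightarrow> salg" where
  "S_Ad s \<xi> = quat_to_salg
     (frechet_derivative (\<lambda>x. S_mult (S_mult s x) (S_inv s)) (at S_one) (salg_to_quat \<xi>))"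

definition S_coAd :: "sgroup \<Rightarrow> salg \<Rightarrow> salg" where
  "S_coAd s = adjoint (S_Ad (S_inv s))"

definition coadjoint_orbit :: "salg set \<Rightarrow> bool" where
  "coadjoint_orbit \<O> \<longleftrightarrow> (\<exists>\<mu>. \<O> = (\<lambda>s. S_coAd s \<mu>) ` S_carrier)"

definition comm :: "real^3 \<Rightarrow> real^3 \<Rightarrow> real^3" where
  "comm x y = qim (imq x * imq y - imq y * imq x)"

fun S_bracket :: "salg \<Rightarrow> salg \<Rightarrow> salg" where
  "S_bracket (x, y, u) (x', y', u') =
     (comm x x', comm y y', (imq x * u' - u' * imq y) - (imq x' * u - u * imq y'))"

definition S_coad :: "salg \<Rightarrow> salg \<Rightarrow> salg" where
  "S_coad \<xi> = adjoint (S_bracket \<xi>)"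

text \<open>The Kirillov--Kostant--Souriau form on orbits in \<open>\<ss>\<^sup>*\<^sub>\<plusminus>\<close>:
  \<open>\<omega>(ad\<^sup>*\<^sub>\<xi> \<mu>, ad\<^sup>*\<^sub>\<eta> \<mu>) = \<plusminus>\<langle>\<mu>, [\<xi>, \<eta>]\<rangle>\<close>, where the sign \<open>\<plusminus>\<close> is \<open>\<sigma>\<close>.  Equivalently
  \<open>\<omega>(X\<^sub>f, X\<^sub>h) = {f, h}\<close> for the Lie--Poisson bracket below and \<open>X\<^sub>f = {f, \<cdot>}\<close>.\<close>

definition kks_form :: "real \<Rightarrow> salg \<Rightarrow> salg \<Rightarrow> salg \<Rightarrow> real" where
  "kks_form \<sigma> \<mu> u v = (THE r. \<exists>\<xi> \<eta>. u = S_coad \<xi> \<mu> \<and> v = S_coad \<eta> \<mu> \<and>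
     r = \<sigma> * (\<mu> \<bullet> S_bracket \<xi> \<eta>))"

definition orbit_space :: "real \<Rightarrow> salg set \<Rightarrow> salg symp_space" where
  "orbit_space \<sigma> \<O> = embedded_symp \<O> (kks_form \<sigma>)"

definition grad :: "('a::real_inner \<Rightarrow> real) \<Rightarrow> 'a \<Rightarrow> 'a" where
  "grad f x = (THE D. GDERIV f x :> D)"

definition lie_poisson :: "real \<Rightarrow> (salg \<Rightarrow> real) \<Rightarrow> (salg \<Rightarrow> real) \<Rightarrow> salg \<Rightarrow> real" where
  "lie_poisson \<sigma> f h \<mu> =
     (case (\<mu>, grad f \<mu>, grad h \<mu>) of ((A1, A2, gD), (f1, f2, f3), (h1, h2, h3)) \<Rightarrow>
        \<sigma> * (A1 \<bullet> comm f1 h1) + \<sigma> * (A2 \<bullet> comm f2 h2) +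
        \<sigma> * (gD \<bullet> ((imq f1 * h3 - h3 * imq f2) - (imq h1 * f3 - f3 * imq h2))))"

lemma lie_poisson_S_bracket:
  "lie_poisson \<sigma> f h \<mu> = \<sigma> * (\<mu> \<bullet> S_bracket (grad f \<mu>) (grad h \<mu>))"
  by (cases \<mu>; cases "grad f \<mu>"; cases "grad h \<mu>")
    (simp add: lie_poisson_def inner_Pair algebra_simps)

definition casimir :: "real \<Rightarrow> (salg \<Rightarrow> real) \<Rightarrow> bool" where
  "casimir \<sigma> C \<longleftrightarrow> smooth_on UNIV C \<and>
     (\<forall>h. smooth_on UNIV h \<longrightarrow> (\<forall>\<mu>. lie_poisson \<sigma> C h \<mu> = 0))"

fun C1 :: "salg \<Rightarrow> real" where
  "C1 (A1, A2, gD) = (norm gD)\<^sup>2"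

fun C2 :: "salg \<Rightarrow> real" where
  "C2 (A1, A2, gD) = (norm (imq A1 * gD + gD * imq A2))\<^sup>2"

definition casimir_level :: "real \<Rightarrow> salg set" where
  "casimir_level c = {\<mu>. C1 \<mu> = 1 \<and> C2 \<mu> = c}"

end

theory Submission
  imports Defs
begin

text \<open>Dividing the left action of \<open>S\<^sup>3\<close> out of \<open>M\<close> leaves the left-invariant map
  \<open>\<Phi> = (R\<^sub>1, R\<^sub>2, g\<^sub>L)\<close>.  Since \<open>A\<^sub>1 g\<^sub>D + g\<^sub>D A\<^sub>2 = g\<^sub>1\<^sup>-\<^sup>1 J\<^sub>L g\<^sub>2\<close>, it sends the momentum level
  \<open>J\<^sub>L = \<nu>\<close> to the Casimir level \<open>C\<^sub>1 = 1\<close>, \<open>C\<^sub>2 = |\<nu>|\<^sup>2\<close>.  A point over \<open>(A\<^sub>1, A\<^sub>2, g\<^sub>D)\<close> is determined by a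
  unit quaternion \<open>k = g\<^sub>1\<close> that rotates the body momentum \<open>A\<^sub>1 + g\<^sub>D A\<^sub>2 g\<^sub>D\<^sup>-\<^sup>1\<close> to \<open>\<nu>\<close>; such \<open>k\<close>
  always exist, form a single coset of the isotropy group of \<open>\<nu>\<close>, and can be chosen smoothly near any
  given one.  So \<open>\<Phi>\<close> descends to a bijection with smooth local sections.  A tangent vector of the
  momentum level with left-trivialized velocities \<open>x\<close>, \<open>y\<close> is mapped by \<open>\<Phi>\<close> to
  \<open>ad\<^sup>*\<close> of \<open>(x, y, b g\<^sub>D)\<close> for a suitable \<open>b\<close>, and with this choice the canonical form becomes the
  Kirillov--Kostant--Souriau form.  On the right the velocities enter with the opposite sign, which
  reverses the sign of the form.\<close>

section \<open>Smooth maps\<close>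

text \<open>As a rewrite rule the successor equation makes the simplifier loop on induction hypotheses.\<close>

lemmas higher_differentiable_on_Suc = higher_differentiable_on.simps(2)
declare higher_differentiable_on_Suc [simp del]

section \<open>Calculus of maps differentiable to a finite order\<close>

lemma higher_differentiable_on_cong:
  assumes "open U" "\<And>x. x \<in> U \<Longrightarrow> f x = g x"
  shows "higher_differentiable_on U f n \<longleftrightarrow> higher_differentiable_on U g n"
  using assms(2)
proof (induction n arbitrary: f g)
  case 0
  then show ?case by (simp cong: continuous_on_cong)
next
  case (Suc n)
  have *: "higher_differentiable_on U g (Suc n)"
    if "higher_differentiable_on U f (Suc n)" and eq: "\<And>x. x \<in> U \<Longrightarrow> f x = g x" for f g :: "'a \<Rightarrow> 'b"
  proof -
    have d: "f differentiable at x" if "x \<in> U" for x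
      using \<open>higher_differentiable_on U f (Suc n)\<close> that by (simp add: higher_differentiable_on_Suc)
    have "(g has_derivative frechet_derivative f (at x)) (at x)" if "x \<in> U" for x
      using d[OF that] that assms(1) eq
      by (auto simp: frechet_derivative_works intro: has_derivative_transform_within_open)
    moreover from this have "frechet_derivative g (at x) = frechet_derivative f (at x)" if "x \<in> U" for x
      using that by (metis frechet_derivative_at)
    moreover have "higher_differentiable_on U (\<lambda>x. frechet_derivative g (at x) v) n" for v
      using Suc.IH[of "\<lambda>x. frechet_derivative f (at x) v" "\<lambda>x. frechet_derivative g (at x) v"]
        calculation(2) that(1) by (simp add: higher_differentiable_on_Suc)
    ultimately show ?thesis
      by (auto simp: differentiable_def higher_differentiable_on_Suc)
  qed
  show ?case using *[of f g] *[of g f] Suc.prems by metis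
qed

text \<open>Replaces the chosen \<open>frechet_derivative\<close> by any explicit family of
  derivatives, so that the inductions below can use the formulas of the differentiation rules.
  Openness of \<open>U\<close> allows two families that agree on \<open>U\<close> to be exchanged
  under further differentiation.\<close>

lemma higher_differentiable_on_SucI:
  assumes "open U" "\<And>x. x \<in> U \<Longrightarrow> (f has_derivative f' x) (at x)"
    and "\<And>v. higher_differentiable_on U (\<lambda>x. f' x v) n"
  shows "higher_differentiable_on U f (Suc n)"
proof -
  have "frechet_derivative f (at x) = f' x" if "x \<in> U" for x
    using assms(2)[OF that] by (metis frechet_derivative_at)
  then have "higher_differentiable_on U (\<lambda>x. frechet_derivative f (at x) v) n" for v
    using higher_differentiable_on_cong[OF assms(1), of "\<lambda>x. frechet_derivative f (at x) v" "\<lambda>x. f' x v"]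
      assms(3) by simp
  then show ?thesis
    using assms(2) by (auto simp: differentiable_def higher_differentiable_on_Suc)
qed

lemma higher_differentiable_on_SucD:
  assumes "higher_differentiable_on U f (Suc n)"
  obtains f' where "\<And>x. x \<in> U \<Longrightarrow> (f has_derivative f' x) (at x)"
    "\<And>v. higher_differentiable_on U (\<lambda>x. f' x v) n"
  using assms that[of "\<lambda>x. frechet_derivative f (at x)"]
  by (auto simp: frechet_derivative_works[symmetric] higher_differentiable_on_Suc)

lemma higher_differentiable_on_SucE:
  "higher_differentiable_on U f (Suc n) \<Longrightarrow> higher_differentiable_on U f n"
proof (induction n arbitrary: f)
  case 0
  then show ?case
    by (auto intro!: continuous_at_imp_continuous_on differentiable_imp_continuous_within
        simp: higher_differentiable_on_Suc)
next
  case (Suc n)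
  have "f differentiable at x" if "x \<in> U" for x
    using Suc.prems that higher_differentiable_on_Suc by blast
  moreover have "higher_differentiable_on U (\<lambda>x. frechet_derivative f (at x) v) n" for v
    by (rule Suc.IH) (use Suc.prems higher_differentiable_on_Suc in blast)
  ultimately show ?case using higher_differentiable_on_Suc by blast
qed

lemma higher_differentiable_on_subset:
  assumes "V \<subseteq> U"
  shows "higher_differentiable_on U f n \<Longrightarrow> higher_differentiable_on V f n"
proof (induction n arbitrary: f)
  case 0
  then show ?case using assms by (simp add: continuous_on_subset)
next
  case (Suc n)
  from Suc.prems[unfolded higher_differentiable_on_Suc] show ?case
    unfolding higher_differentiable_on_Suc using assms Suc.IH by simp blast
qed

text \<open>Each defining condition is pointwise, and a single neighbourhood of a point serves for
  all directions \<open>v\<close> at once.\<close>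

lemma higher_differentiable_on_local:
  assumes "\<And>x. x \<in> U \<Longrightarrow> \<exists>V. open V \<and> x \<in> V \<and> higher_differentiable_on V f n"
  shows "higher_differentiable_on U f n"
  using assms
proof (induction n arbitrary: f)
  case 0
  then show ?case
    by (metis continuous_at_imp_continuous_on continuous_on_eq_continuous_at higher_differentiable_on.simps(1))
next
  case (Suc n)
  have "f differentiable at x" if "x \<in> U" for x
    using Suc.prems[OF that] higher_differentiable_on_Suc by blast
  moreover have "higher_differentiable_on U (\<lambda>x. frechet_derivative f (at x) v) n" for v
  proof (rule Suc.IH)
    fix x assume "x \<in> U"
    from Suc.prems[OF this] show "\<exists>V. open V \<and> x \<in> V \<and>
        higher_differentiable_on V (\<lambda>x. frechet_derivative f (at x) v) n"
      unfolding higher_differentiable_on_Suc by (elim exE conjE) (intro exI conjI, assumption+, erule spec)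
  qed
  ultimately show ?case using higher_differentiable_on_Suc by blast
qed

lemma higher_differentiable_on_const:
  "higher_differentiable_on U (\<lambda>x. c) n"
proof (induction n arbitrary: c)
  case (Suc n)
  \<comment> \<open>The derivative of a constant is the constant \<open>0\<close>, which is why the
    value is generalized in the induction.\<close>
  then show ?case using Suc[of 0] by (simp add: higher_differentiable_on_Suc)
qed simp

lemma higher_differentiable_on_add:
  assumes "open U" "higher_differentiable_on U f n" "higher_differentiable_on U g n"
  shows "higher_differentiable_on U (\<lambda>x. f x + g x) n"
  using assms(2,3)
proof (induction n arbitrary: f g)
  case 0
  then show ?case by (simp add: continuous_on_add)
next
  case (Suc n)
  obtain f' where f': "\<And>x. x \<in> U \<Longrightarrow> (f has_derivative f' x) (at x)"
    "\<And>v. higher_differentiable_on U (\<lambda>x. f' x v) n"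
    using higher_differentiable_on_SucD[OF Suc.prems(1)] by blast
  obtain g' where g': "\<And>x. x \<in> U \<Longrightarrow> (g has_derivative g' x) (at x)"
    "\<And>v. higher_differentiable_on U (\<lambda>x. g' x v) n"
    using higher_differentiable_on_SucD[OF Suc.prems(2)] by blast
  show ?case
    by (rule higher_differentiable_on_SucI[where f' = "\<lambda>x v. f' x v + g' x v"])
      (auto intro!: assms(1) Suc.IH f' g' has_derivative_add)
qed

text \<open>By the Leibniz rule the derivative is again a sum of values of \<open>B\<close>. The
  induction hypothesis then needs the undifferentiated factors to order \<open>n\<close> too, which
  \<open>higher_differentiable_on_SucE\<close> supplies.\<close>

lemma higher_differentiable_on_bounded_bilinear:
  assumes B: "bounded_bilinear B" and "open U"
    "higher_differentiable_on U f n" "higher_differentiable_on U g n"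
  shows "higher_differentiable_on U (\<lambda>x. B (f x) (g x)) n"
  using assms(3,4)
proof (induction n arbitrary: f g)
  case 0
  then show ?case by (simp add: bounded_bilinear.continuous_on[OF B])
next
  case (Suc n)
  obtain f' where f': "\<And>x. x \<in> U \<Longrightarrow> (f has_derivative f' x) (at x)"
    "\<And>v. higher_differentiable_on U (\<lambda>x. f' x v) n"
    using higher_differentiable_on_SucD[OF Suc.prems(1)] by blast
  obtain g' where g': "\<And>x. x \<in> U \<Longrightarrow> (g has_derivative g' x) (at x)"
    "\<And>v. higher_differentiable_on U (\<lambda>x. g' x v) n"
    using higher_differentiable_on_SucD[OF Suc.prems(2)] by blast
  show ?case
    by (rule higher_differentiable_on_SucI[where f' = "\<lambda>x v. B (f x) (g' x v) + B (f' x v) (g x)"])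
      (auto intro!: assms(2) Suc.IH f' g' bounded_bilinear.FDERIV[OF B] higher_differentiable_on_add
        Suc.prems[THEN higher_differentiable_on_SucE])
qed

lemma higher_differentiable_on_bounded_linear:
  assumes T: "bounded_linear T" and "open U" "higher_differentiable_on U f n"
  shows "higher_differentiable_on U (\<lambda>x. T (f x)) n"
  using assms(3)
proof (induction n arbitrary: f)
  case 0
  then show ?case by (simp add: bounded_linear.continuous_on[OF T])
next
  case (Suc n)
  obtain f' where f': "\<And>x. x \<in> U \<Longrightarrow> (f has_derivative f' x) (at x)"
    "\<And>v. higher_differentiable_on U (\<lambda>x. f' x v) n"
    using higher_differentiable_on_SucD[OF Suc.prems(1)] by blast
  show ?case
    by (rule higher_differentiable_on_SucI[where f' = "\<lambda>x v. T (f' x v)"])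
      (auto intro!: assms(2) Suc.IH f' bounded_linear.has_derivative[OF T])
qed

lemma higher_differentiable_on_ident:
  assumes "open U" shows "higher_differentiable_on U (\<lambda>x. x) n"
  by (cases n) (auto intro!: assms higher_differentiable_on_SucI[where f' = "\<lambda>x v. v"]
      higher_differentiable_on_const)

lemma higher_differentiable_on_Pair:
  assumes "open U" "higher_differentiable_on U f n" "higher_differentiable_on U g n"
  shows "higher_differentiable_on U (\<lambda>x. (f x, g x)) n"
proof -
  have "bounded_linear (\<lambda>a. (a, 0))" "bounded_linear (\<lambda>b. (0, b))"
    by (intro bounded_linear_Pair bounded_linear_ident bounded_linear_zero)+
  from higher_differentiable_on_add[OF assms(1)
      higher_differentiable_on_bounded_linear[OF this(1) assms(1,2)]
      higher_differentiable_on_bounded_linear[OF this(2) assms(1,3)]]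
  show ?thesis by simp
qed

lemma higher_differentiable_on_sum:
  assumes "open U" "\<And>i. i \<in> I \<Longrightarrow> higher_differentiable_on U (f i) n"
  shows "higher_differentiable_on U (\<lambda>x. \<Sum>i\<in>I. f i x) n"
  using assms(2)
  by (induction I rule: infinite_finite_induct)
    (auto intro!: higher_differentiable_on_const higher_differentiable_on_add assms(1))

text \<open>The chain rule gives \<open>g' (f x) (f' x v)\<close>, whose direction varies with
  \<open>x\<close>, while the induction hypothesis covers fixed directions only. Expanding the
  direction in a basis gives a finite sum of products with fixed directions, hence the
  finite-dimensional middle space.\<close>

lemma higher_differentiable_on_compose:
  fixes g :: "'b::euclidean_space \<Rightarrow> 'c::real_normed_vector"
  assumes "open U" "open V" "f ` U \<subseteq> V"
    and "higher_differentiable_on U f n" "higher_differentiable_on V g n"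
  shows "higher_differentiable_on U (\<lambda>x. g (f x)) n"
  using assms(4,5)
proof (induction n arbitrary: g)
  case 0
  then show ?case using assms(3) by (auto intro: continuous_on_compose2)
next
  case (Suc n)
  obtain f' where f': "\<And>x. x \<in> U \<Longrightarrow> (f has_derivative f' x) (at x)"
    "\<And>v. higher_differentiable_on U (\<lambda>x. f' x v) n"
    using higher_differentiable_on_SucD[OF Suc.prems(1)] by blast
  obtain g' where g': "\<And>x. x \<in> V \<Longrightarrow> (g has_derivative g' x) (at x)"
    "\<And>v. higher_differentiable_on V (\<lambda>x. g' x v) n"
    using higher_differentiable_on_SucD[OF Suc.prems(2)] by blast
  show ?case
  proof (rule higher_differentiable_on_SucI[where
        f' = "\<lambda>x v. \<Sum>b\<in>Basis. (f' x v \<bullet> b) *\<^sub>R g' (f x) b"])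
    show "open U" by fact
    fix x assume x: "x \<in> U"
    then have d: "(g has_derivative g' (f x)) (at (f x))" using g' assms(3) by auto
    have rep: "g' (f x) v = (\<Sum>b\<in>Basis. (v \<bullet> b) *\<^sub>R g' (f x) b)" for v
    proof -
      interpret linear "g' (f x)"
        using d has_derivative_linear by blast
      have "g' (f x) v = g' (f x) (\<Sum>b\<in>Basis. (v \<bullet> b) *\<^sub>R b)"
        by (simp only: euclidean_representation)
      also have "\<dots> = (\<Sum>b\<in>Basis. (v \<bullet> b) *\<^sub>R g' (f x) b)"
        by (simp only: sum scaleR)
      finally show ?thesis .
    qed
    show "((\<lambda>x. g (f x)) has_derivative (\<lambda>v. \<Sum>b\<in>Basis. (f' x v \<bullet> b) *\<^sub>R g' (f x) b)) (at x)"
      using has_derivative_compose[OF f'(1)[OF x] d] by (rule has_derivative_eq_rhs) (rule ext, rule rep)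
  next
    show "higher_differentiable_on U (\<lambda>x. \<Sum>b\<in>Basis. (f' x v \<bullet> b) *\<^sub>R g' (f x) b) n" for v
      by (intro higher_differentiable_on_sum assms(1)
          higher_differentiable_on_bounded_bilinear[OF bounded_bilinear_scaleR]
          higher_differentiable_on_bounded_linear[OF bounded_linear_inner_left]
          f' Suc.IH g' Suc.prems[THEN higher_differentiable_on_SucE])
  qed
qed

text \<open>The derivative of \<open>r = inverse (sqrt x)\<close> is \<open>- r^3 / 2\<close>, a
  polynomial in \<open>r\<close>, so the product rule closes the induction.\<close>

lemma higher_differentiable_on_inverse_sqrt:
  "higher_differentiable_on {0<..} (\<lambda>x::real. inverse (sqrt x)) n"
proof (induction n)
  case 0
  then show ?case by (auto intro!: continuous_intros)
next
  case (Suc n)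
  let ?r = "\<lambda>x::real. inverse (sqrt x)"
  note m = higher_differentiable_on_bounded_bilinear[OF bounded_bilinear_mult open_greaterThan]
  show ?case
  proof (rule higher_differentiable_on_SucI[where f' = "\<lambda>x v. (?r x * (?r x * ?r x)) * (- v / 2)"])
    fix x :: real assume "x \<in> {0<..}"
    then have x: "x > 0" by simp
    have "(?r has_real_derivative - (?r x * (?r x / 2) * ?r x)) (at x)"
      by (rule DERIV_inverse'[OF DERIV_real_sqrt[OF x]]) (use x in simp)
    moreover have "- (?r x * (?r x / 2) * ?r x) * v = (?r x * (?r x * ?r x)) * (- v / 2)" for v
      by simp
    ultimately show "(?r has_derivative (\<lambda>v. (?r x * (?r x * ?r x)) * (- v / 2))) (at x)"
      unfolding has_field_derivative_def by (elim has_derivative_eq_rhs) (rule ext)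
  next
    show "higher_differentiable_on {0<..} (\<lambda>x. (?r x * (?r x * ?r x)) * (- v / 2)) n" for v
      by (rule m[OF m[OF Suc m[OF Suc Suc]] higher_differentiable_on_const])
  qed (rule open_greaterThan)
qed

section \<open>Closure properties of smooth maps\<close>

lemma smooth_on_cong:
  assumes "open U" "\<And>x. x \<in> U \<Longrightarrow> f x = g x"
  shows "smooth_on U f \<longleftrightarrow> smooth_on U g"
  using higher_differentiable_on_cong[OF assms] by (simp add: smooth_on_def)

lemma smooth_on_subset: "smooth_on U f \<Longrightarrow> V \<subseteq> U \<Longrightarrow> smooth_on V f"
  unfolding smooth_on_def by (rule allI, rule higher_differentiable_on_subset[of V U]) simp_all

lemma smooth_on_local:
  assumes "\<And>x. x \<in> U \<Longrightarrow> \<exists>V. open V \<and> x \<in> V \<and> smooth_on V f"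
  shows "smooth_on U f"
  unfolding smooth_on_def
proof (intro allI higher_differentiable_on_local)
  fix n x assume "x \<in> U"
  with assms obtain V where "open V" "x \<in> V" "smooth_on V f" by blast
  then show "\<exists>V. open V \<and> x \<in> V \<and> higher_differentiable_on V f n"
    by (auto simp: smooth_on_def)
qed

lemma smooth_on_imp_differentiable: "smooth_on U f \<Longrightarrow> x \<in> U \<Longrightarrow> f differentiable at x"
  unfolding smooth_on_def by (drule spec[of _ "Suc 0"]) (simp add: higher_differentiable_on_Suc)

lemma smooth_on_imp_continuous_on: "smooth_on U f \<Longrightarrow> continuous_on U f"
  unfolding smooth_on_def by (drule spec[of _ 0]) simp

lemma smooth_on_const: "smooth_on U (\<lambda>x. c)"
  unfolding smooth_on_def by (rule allI, rule higher_differentiable_on_const)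

lemma smooth_on_ident: "open U \<Longrightarrow> smooth_on U (\<lambda>x. x)"
  unfolding smooth_on_def by (rule allI, rule higher_differentiable_on_ident)

lemma smooth_on_bounded_linear:
  "bounded_linear T \<Longrightarrow> open U \<Longrightarrow> smooth_on U f \<Longrightarrow> smooth_on U (\<lambda>x. T (f x))"
  unfolding smooth_on_def by (rule allI, rule higher_differentiable_on_bounded_linear) simp_all

lemma smooth_on_bounded_bilinear:
  "bounded_bilinear B \<Longrightarrow> open U \<Longrightarrow> smooth_on U f \<Longrightarrow> smooth_on U g \<Longrightarrow>
    smooth_on U (\<lambda>x. B (f x) (g x))"
  unfolding smooth_on_def by (rule allI, rule higher_differentiable_on_bounded_bilinear) simp_all

lemma smooth_on_add:
  "open U \<Longrightarrow> smooth_on U f \<Longrightarrow> smooth_on U g \<Longrightarrow> smooth_on U (\<lambda>x. f x + g x)"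
  unfolding smooth_on_def by (rule allI, rule higher_differentiable_on_add) simp_all

lemma smooth_on_Pair:
  "open U \<Longrightarrow> smooth_on U f \<Longrightarrow> smooth_on U g \<Longrightarrow> smooth_on U (\<lambda>x. (f x, g x))"
  unfolding smooth_on_def by (rule allI, rule higher_differentiable_on_Pair) simp_all

lemma smooth_on_sum:
  "open U \<Longrightarrow> (\<And>i. i \<in> I \<Longrightarrow> smooth_on U (f i)) \<Longrightarrow> smooth_on U (\<lambda>x. \<Sum>i\<in>I. f i x)"
  unfolding smooth_on_def by (rule allI, rule higher_differentiable_on_sum) simp_all

lemma smooth_on_compose:
  fixes g :: "'b::euclidean_space \<Rightarrow> 'c::real_normed_vector"
  shows "open U \<Longrightarrow> open V \<Longrightarrow> f ` U \<subseteq> V \<Longrightarrow> smooth_on U f \<Longrightarrow> smooth_on V g \<Longrightarrow>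
    smooth_on U (\<lambda>x. g (f x))"
  unfolding smooth_on_def by (rule allI, rule higher_differentiable_on_compose[of U V f]) simp_all

lemmas smooth_on_mult = smooth_on_bounded_bilinear[OF bounded_bilinear_mult]
lemmas smooth_on_scaleR = smooth_on_bounded_bilinear[OF bounded_bilinear_scaleR]
lemmas smooth_on_inner = smooth_on_bounded_bilinear[OF bounded_bilinear_inner]
lemmas smooth_on_uminus = smooth_on_bounded_linear[OF bounded_linear_minus[OF bounded_linear_ident]]
lemmas smooth_on_fst = smooth_on_bounded_linear[OF bounded_linear_fst]
lemmas smooth_on_snd = smooth_on_bounded_linear[OF bounded_linear_snd]

lemma smooth_on_diff:
  "open U \<Longrightarrow> smooth_on U f \<Longrightarrow> smooth_on U g \<Longrightarrow> smooth_on U (\<lambda>x. f x - g x)"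
  unfolding diff_conv_add_uminus by (rule smooth_on_add[OF _ _ smooth_on_uminus])

lemma smooth_on_sgn:
  fixes f :: "'a::real_normed_vector \<Rightarrow> 'b::real_inner"
  assumes "open U" "smooth_on U f" "\<And>x. x \<in> U \<Longrightarrow> f x \<noteq> 0"
  shows "smooth_on U (\<lambda>x. sgn (f x))"
proof -
  have r: "smooth_on {0<..} (\<lambda>x::real. inverse (sqrt x))"
    by (simp add: smooth_on_def higher_differentiable_on_inverse_sqrt)
  have "smooth_on U (\<lambda>x. inverse (sqrt (f x \<bullet> f x)))"
    by (rule smooth_on_compose[OF assms(1) open_greaterThan _ smooth_on_inner[OF assms(1,2,2)] r])
      (use assms(3) in auto)
  from smooth_on_scaleR[OF assms(1) this assms(2)] show ?thesis
    by (simp add: sgn_div_norm norm_eq_sqrt_inner)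
qed

section \<open>Embedded submanifolds and reduction\<close>

lemma pts_embedded [simp]: "pts (embedded X) = X"
  by (simp add: embedded_def)

lemma funs_embedded_iff:
  "f \<in> funs (embedded X) \<longleftrightarrow>
    (\<forall>x\<in>X. \<exists>U F. open U \<and> x \<in> U \<and> smooth_on U F \<and> (\<forall>y\<in>U \<inter> X. f y = F y))"
  by (simp add: embedded_def)

lemma smooth_on_imp_funs_embedded: "smooth_on UNIV F \<Longrightarrow> F \<in> funs (embedded X)"
  unfolding funs_embedded_iff by (metis UNIV_I open_UNIV)

lemma funs_embedded_cong:
  assumes "\<And>x. x \<in> X \<Longrightarrow> f x = g x"
  shows "f \<in> funs (embedded X) \<longleftrightarrow> g \<in> funs (embedded X)"
proof -
  have "(\<forall>y\<in>U \<inter> X. f y = F y) \<longleftrightarrow> (\<forall>y\<in>U \<inter> X. g y = F y)" for U F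
    using assms by simp
  then show ?thesis by (simp only: funs_embedded_iff)
qed

lemma funs_embedded_subset: "f \<in> funs (embedded Y) \<Longrightarrow> X \<subseteq> Y \<Longrightarrow> f \<in> funs (embedded X)"
  unfolding funs_embedded_iff by (meson Int_iff subsetD)

lemma inner_in_funs_embedded: "(\<lambda>x. x \<bullet> b) \<in> funs (embedded X)"
  by (intro smooth_on_imp_funs_embedded smooth_on_bounded_linear[OF bounded_linear_inner_left]
      smooth_on_ident open_UNIV)

text \<open>A smooth function on \<open>Z\<close> is only locally the restriction of an ambient one,
  so \<open>U\<close> is shrunk to the preimage of the domain of such an extension. The local form
  serves global maps, local sections and curves alike.\<close>

lemma funs_embedded_compose_local:
  fixes s :: "'a::real_normed_vector \<Rightarrow> 'b::euclidean_space"
  assumes h: "h \<in> funs (embedded Z)" and U: "open U" "x \<in> U" "x \<in> X" "smooth_on U s"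
    and s: "\<And>y. y \<in> U \<inter> X \<Longrightarrow> s y \<in> Z"
  shows "\<exists>W F. open W \<and> x \<in> W \<and> W \<subseteq> U \<and> smooth_on W F \<and> (\<forall>y\<in>W \<inter> X. h (s y) = F y)"
proof -
  from s[of x] U have "s x \<in> Z" by simp
  with h obtain V F where F: "open V" "s x \<in> V" "smooth_on V F" "\<forall>y\<in>V \<inter> Z. h y = F y"
    unfolding funs_embedded_iff by blast
  have "open (s -` V \<inter> U)"
    using continuous_on_open_vimage[OF U(1)] smooth_on_imp_continuous_on[OF U(4)] F(1) by blast
  moreover have "smooth_on (s -` V \<inter> U) (\<lambda>y. F (s y))"
    by (rule smooth_on_compose[OF calculation F(1) _ smooth_on_subset[OF U(4)] F(3)]) auto
  moreover have "\<forall>y\<in>(s -` V \<inter> U) \<inter> X. h (s y) = F (s y)"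
    using F(4) s by blast
  ultimately show ?thesis
    using U(2) F(2) by (intro exI[of _ "s -` V \<inter> U"] exI[of _ "\<lambda>y. F (s y)"]) auto
qed

lemma funs_embedded_compose:
  fixes \<phi> :: "'a::euclidean_space \<Rightarrow> 'b::euclidean_space"
  assumes "h \<in> funs (embedded Y)" "smooth_on UNIV \<phi>" "\<phi> ` X \<subseteq> Y"
  shows "h \<circ> \<phi> \<in> funs (embedded X)"
  unfolding funs_embedded_iff
proof
  fix x assume "x \<in> X"
  with funs_embedded_compose_local[OF assms(1) open_UNIV UNIV_I _ assms(2), of x X] assms(3)
  show "\<exists>U F. open U \<and> x \<in> U \<and> smooth_on U F \<and> (\<forall>y\<in>U \<inter> X. (h \<circ> \<phi>) y = F y)"
    by fastforce
qed

section \<open>Smooth curves, velocities and tangent maps\<close>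

text \<open>The coordinate functions are among the test functions and recover the curve; conversely,
  every test function extends smoothly near each point of the curve.\<close>

lemma smooth_curve_embedded_iff:
  "smooth_curve (embedded X) \<gamma> \<longleftrightarrow>
    (\<exists>e>0. \<gamma> ` {-e<..<e} \<subseteq> X \<and> smooth_on {-e<..<e} \<gamma>)"
proof
  assume "smooth_curve (embedded X) \<gamma>"
  then obtain e where e: "e > 0" "\<forall>t\<in>{-e<..<e}. \<gamma> t \<in> X"
      "\<forall>f\<in>funs (embedded X). smooth_on {-e<..<e} (f \<circ> \<gamma>)"
    by (auto simp: smooth_curve_def)
  have "smooth_on {-e<..<e} (\<lambda>t. \<Sum>b\<in>Basis. (\<gamma> t \<bullet> b) *\<^sub>R b)"
    by (intro smooth_on_sum smooth_on_scaleR smooth_on_const)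
      (use e(3) inner_in_funs_embedded in \<open>fastforce simp: o_def\<close>)+
  then show "\<exists>e>0. \<gamma> ` {-e<..<e} \<subseteq> X \<and> smooth_on {-e<..<e} \<gamma>"
    using e by (auto simp: euclidean_representation)
next
  assume "\<exists>e>0. \<gamma> ` {-e<..<e} \<subseteq> X \<and> smooth_on {-e<..<e} \<gamma>"
  then obtain e where e: "e > 0" "\<gamma> ` {-e<..<e} \<subseteq> X" "smooth_on {-e<..<e} \<gamma>" by blast
  have "smooth_on {-e<..<e} (f \<circ> \<gamma>)" if "f \<in> funs (embedded X)" for f
  proof (rule smooth_on_local)
    fix t assume "t \<in> {-e<..<e}"
    from funs_embedded_compose_local[OF that _ this this e(3)] e(2)
    obtain W F where W: "open W" "t \<in> W" "W \<subseteq> {-e<..<e}" "smooth_on W F" "\<forall>y\<in>W \<inter> {-e<..<e}. f (\<gamma> y) = F y"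
      by (auto simp del: greaterThanLessThan_iff)
    then show "\<exists>V. open V \<and> t \<in> V \<and> smooth_on V (f \<circ> \<gamma>)"
      using smooth_on_cong[OF W(1), of "f \<circ> \<gamma>" F] by (intro exI[of _ W]) auto
  qed
  with e show "smooth_curve (embedded X) \<gamma>"
    by (auto simp: smooth_curve_def)
qed

lemma smooth_curve_embedded_differentiable:
  assumes "smooth_curve (embedded X) \<gamma>"
  shows "(\<gamma> has_vector_derivative vector_derivative \<gamma> (at 0)) (at 0)"
proof -
  have "\<gamma> differentiable at 0"
    using assms smooth_on_imp_differentiable[of _ \<gamma> 0] by (auto simp: smooth_curve_embedded_iff)
  then show ?thesis by (simp add: vector_derivative_works)
qed

text \<open>The coordinate functions belong to \<open>funs\<close>, so the derivation does not take
  its default \<open>0\<close> on them and its coordinates are those of the usual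
  derivative.\<close>

lemma ambient_velocity:
  assumes "smooth_curve (embedded X) \<gamma>"
  shows "ambient (velocity (embedded X) \<gamma>) = vector_derivative \<gamma> (at 0)"
proof -
  have "deriv (\<lambda>t. \<gamma> t \<bullet> b) 0 = vector_derivative \<gamma> (at 0) \<bullet> b" for b
    using bounded_linear.has_vector_derivative[OF bounded_linear_inner_left
        smooth_curve_embedded_differentiable[OF assms], of b]
    by (intro DERIV_imp_deriv) (simp add: has_real_derivative_iff_has_vector_derivative)
  then show ?thesis
    by (simp add: ambient_def velocity_def inner_in_funs_embedded o_def euclidean_representation)
qed

lemma eventually_smooth_curve:
  assumes "smooth_curve X \<gamma>"
  shows "\<forall>\<^sub>F t in nhds 0. \<gamma> t \<in> pts X"
proof -
  from assms obtain e where "e > 0" "\<forall>t\<in>{-e<..<e}. \<gamma> t \<in> pts X"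
    by (auto simp: smooth_curve_def)
  then show ?thesis
    by (auto simp: eventually_nhds_metric dist_real_def abs_less_iff intro!: exI[of _ e])
qed

lemma velocity_cong:
  assumes "\<forall>\<^sub>F t in nhds 0. \<gamma> t = \<delta> t"
  shows "velocity X \<gamma> = velocity X \<delta>"
proof -
  have "deriv (f \<circ> \<gamma>) 0 = deriv (f \<circ> \<delta>) 0" for f :: "'a \<Rightarrow> real"
    by (rule deriv_cong_ev) (use assms in \<open>auto elim: eventually_mono\<close>)
  then show ?thesis unfolding velocity_def by presburger
qed

lemma push_velocity:
  assumes "\<And>g. g \<in> funs Y \<Longrightarrow> g \<circ> \<phi> \<in> funs X"
  shows "push Y \<phi> (velocity X \<gamma>) = velocity Y (\<phi> \<circ> \<gamma>)"
  using assms by (auto simp: push_def velocity_def comp_assoc)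

lemma smooth_curve_push:
  assumes "\<And>g. g \<in> funs Y \<Longrightarrow> g \<circ> \<phi> \<in> funs X" "\<phi> ` pts X \<subseteq> pts Y" "smooth_curve X \<gamma>"
  shows "smooth_curve Y (\<phi> \<circ> \<gamma>)"
proof -
  from assms(3) obtain e where "e > 0" "\<forall>t\<in>{-e<..<e}. \<gamma> t \<in> pts X"
      "\<forall>f\<in>funs X. smooth_on {-e<..<e} (f \<circ> \<gamma>)"
    by (auto simp: smooth_curve_def)
  then show ?thesis
    using assms(1,2) unfolding smooth_curve_def
    by (intro exI[of _ e]) (auto simp: comp_assoc[symmetric])
qed

text \<open>Tangent vectors do not see the symplectic form, so they may be computed in
  \<open>embedded X\<close> instead of \<open>embedded_symp X \<omega>\<close>.\<close>

lemma
  assumes "pts X = pts Y" "funs X = funs Y"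
  shows velocity_space_cong: "velocity X \<gamma> = velocity Y \<gamma>"
    and tangent_space_cong: "tangent X x = tangent Y x"
  using assms by (auto simp: smooth_curve_def velocity_def tangent_def)

lemma embedded_symp_simps [simp]:
  "pts (embedded_symp X \<omega>) = X" "funs (embedded_symp X \<omega>) = funs (embedded X)"
  "form (embedded_symp X \<omega>) x D E = \<omega> x (ambient D) (ambient E)"
  by (simp_all add: embedded_symp_def)

lemma diffeo_embedded:
  fixes F :: "'a::euclidean_space \<Rightarrow> 'b::euclidean_space"
  assumes "smooth_on UNIV F" "smooth_on UNIV G"
    and "\<And>x. x \<in> X \<Longrightarrow> F x \<in> Y \<and> G (F x) = x" "\<And>y. y \<in> Y \<Longrightarrow> G y \<in> X \<and> F (G y) = y"
  shows "diffeo (embedded X) (embedded Y) F"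
proof -
  have bij: "bij_betw F X Y"
    by (rule bij_betw_byWitness[where f' = G]) (use assms in auto)
  have inv: "inv_into X F y = G y" if "y \<in> Y" for y
    using assms(3,4) that bij by (metis bij_betw_imp_inj_on inv_into_f_f)
  have "f \<circ> inv_into X F \<in> funs (embedded Y)" if "f \<in> funs (embedded X)" for f
  proof -
    have "f \<circ> G \<in> funs (embedded Y)"
      using assms(4) by (intro funs_embedded_compose[OF that assms(2)]) auto
    then show ?thesis
      by (rule iffD1[OF funs_embedded_cong, rotated]) (simp add: inv)
  qed
  moreover have "g \<circ> F \<in> funs (embedded X)" if "g \<in> funs (embedded Y)" for g
    using assms(3) by (intro funs_embedded_compose[OF that assms(1)]) auto
  ultimately show ?thesis
    using bij by (simp add: diffeo_def)
qed

section \<open>Descent of an invariant map to the reduced space\<close>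

text \<open>By \<open>fibre\<close> the map \<Phi> descends to a bijection. Smoothness on the
  quotient is defined by pullback along \<pi>, so the descended map is smooth, and the local
  sections \<open>sect\<close> make its inverse smooth. The sections also lift tangent vectors, and
  \<open>form\<close> gives every lift the same value, as the definite description in the reduced
  form demands.\<close>

theorem reduced_space_symplectomorphism:
  fixes \<Phi> :: "'a::euclidean_space \<Rightarrow> 'b::euclidean_space"
    and X :: "'a set" and \<omega> and J :: "'a \<Rightarrow> 'c" and \<mu> :: 'c
    and G :: "'g set" and act :: "'g \<Rightarrow> 'a \<Rightarrow> 'a" and coad :: "'g \<Rightarrow> 'c \<Rightarrow> 'c"
  defines "Z \<equiv> level_set (embedded_symp X \<omega>) J \<mu>"
    and "\<pi> \<equiv> action_orbit (isotropy G coad \<mu>) act"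
  assumes \<Phi>: "smooth_on UNIV \<Phi>" "\<Phi> ` Z = Y"
    and fibre: "\<And>z z'. z \<in> Z \<Longrightarrow> z' \<in> Z \<Longrightarrow> \<pi> z = \<pi> z' \<longleftrightarrow> \<Phi> z = \<Phi> z'"
    and sect: "\<And>z. z \<in> Z \<Longrightarrow> \<exists>U s. open U \<and> \<Phi> z \<in> U \<and> smooth_on U s \<and> s (\<Phi> z) = z \<and>
      (\<forall>y\<in>U \<inter> Y. s y \<in> Z \<and> \<Phi> (s y) = y)"
    and form: "\<And>\<gamma> \<delta>. smooth_curve (embedded Z) \<gamma> \<Longrightarrow> smooth_curve (embedded Z) \<delta> \<Longrightarrow> \<gamma> 0 = \<delta> 0 \<Longrightarrow>
      \<omega> (\<gamma> 0) (vector_derivative \<gamma> (at 0)) (vector_derivative \<delta> (at 0)) =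
      \<eta> (\<Phi> (\<gamma> 0)) (vector_derivative (\<Phi> \<circ> \<gamma>) (at 0)) (vector_derivative (\<Phi> \<circ> \<delta>) (at 0))"
  shows "\<exists>\<phi>. symplectomorphism (reduced_space (embedded_symp X \<omega>) G act coad J \<mu>)
    (embedded_symp Y \<eta>) \<phi> \<and> (\<forall>z\<in>Z. \<phi> (\<pi> z) = \<Phi> z)"
proof -
  define M where "M = embedded_symp X \<omega>"
  define Q where "Q = \<lparr>pts = \<pi> ` Z, funs = {f. f \<circ> \<pi> \<in> funs (embedded Z)}\<rparr>"
  define R where "R = reduced_space M G act coad J \<mu>"
  define rform where "rform = (\<lambda>c D E. THE r. \<exists>z\<in>Z. \<exists>D'\<in>tangent (embedded Z) z.
     \<exists>E'\<in>tangent (embedded Z) z. \<pi> z = c \<and> push Q \<pi> D' = D \<and> push Q \<pi> E' = E \<and>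
           r = form M z (push M id D') (push M id E'))"
  have level: "level_set M J \<mu> = Z" by (simp add: M_def Z_def)
  have R: "pts R = pts Q" "funs R = funs Q" "form R = rform"
    by (simp_all only: R_def Q_def rform_def reduced_space_def Let_def level M_def[symmetric]
        \<pi>_def[symmetric] pts_embedded smooth_space.simps symp_space.simps)
  have Q: "pts Q = \<pi> ` Z" "f \<in> funs Q \<longleftrightarrow> f \<circ> \<pi> \<in> funs (embedded Z)" for f
    by (simp_all add: Q_def)
  have ZX: "Z \<subseteq> X" by (auto simp: Z_def level_set_def)
  \<comment> \<open>A representative is chosen arbitrarily; \<open>fibre\<close> makes the value
    independent of it.\<close>
  define \<phi> where "\<phi> c = \<Phi> (SOME z. z \<in> Z \<and> \<pi> z = c)" for c
  have \<phi>: "\<phi> (\<pi> z) = \<Phi> z" if "z \<in> Z" for z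
  proof -
    have "(SOME z'. z' \<in> Z \<and> \<pi> z' = \<pi> z) \<in> Z \<and> \<pi> (SOME z'. z' \<in> Z \<and> \<pi> z' = \<pi> z) = \<pi> z"
      by (rule someI) (use that in auto)
    then show ?thesis using fibre that unfolding \<phi>_def by blast
  qed
  have bij: "bij_betw \<phi> (pts Q) Y"
    unfolding bij_betw_def inj_on_def using \<phi> fibre \<Phi>(2) by (auto simp: Q image_iff)
  have pull\<Phi>: "g \<circ> \<Phi> \<in> funs (embedded Z)" if "g \<in> funs (embedded Y)" for g
    using \<Phi> by (intro funs_embedded_compose[OF that]) auto
  have pull\<phi>: "g \<circ> \<phi> \<in> funs Q" if "g \<in> funs (embedded Y)" for g
    unfolding Q using pull\<Phi>[OF that] by (rule iffD2[OF funs_embedded_cong, rotated]) (simp add: \<phi>)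
  have pull\<pi>: "f \<circ> \<pi> \<in> funs (embedded Z)" if "f \<in> funs Q" for f
    using that by (simp add: Q)
  have push\<pi>: "push Q \<pi> (velocity (embedded Z) \<gamma>) = velocity Q (\<pi> \<circ> \<gamma>)" for \<gamma>
    by (rule push_velocity) (rule pull\<pi>)
  \<comment> \<open>Near \<open>\<Phi> z\<close> the inverse is \<pi> composed with the section, so
    a smooth function on the quotient becomes locally smooth on \<open>Y\<close>.\<close>
  have pullinv: "f \<circ> inv_into (pts Q) \<phi> \<in> funs (embedded Y)" if f: "f \<in> funs Q" for f
    unfolding funs_embedded_iff
  proof
    fix y assume "y \<in> Y"
    then obtain z where z: "z \<in> Z" "y = \<Phi> z" using \<Phi>(2) by blast
    from sect[OF z(1)] obtain U s where s: "open U" "\<Phi> z \<in> U" "smooth_on U s"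
      "\<And>y. y \<in> U \<inter> Y \<Longrightarrow> s y \<in> Z \<and> \<Phi> (s y) = y" by blast
    have inv: "inv_into (pts Q) \<phi> y = \<pi> (s y)" if "y \<in> U \<inter> Y" for y
      using s(4)[OF that] \<phi>[of "s y"] bij
      by (metis Q(1) bij_betw_imp_inj_on image_eqI inv_into_f_f)
    obtain W F where "open W" "y \<in> W" "W \<subseteq> U" "smooth_on W F" "\<forall>y\<in>W \<inter> Y. (f \<circ> \<pi>) (s y) = F y"
      using funs_embedded_compose_local[OF pull\<pi>[OF f] s(1,2) _ s(3), of Y] s(4) z \<open>y \<in> Y\<close> by auto
    then show "\<exists>U F. open U \<and> y \<in> U \<and> smooth_on U F \<and>
        (\<forall>y\<in>U \<inter> Y. (f \<circ> inv_into (pts Q) \<phi>) y = F y)"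
      using inv by (intro exI[of _ W] exI[of _ F]) auto
  qed
  have diffeo: "diffeo R (embedded_symp Y \<eta>) \<phi>"
    using bij pull\<phi> pullinv by (simp add: diffeo_def R)
  \<comment> \<open>A curve of orbits is tested only against functions on the quotient. Its image in
    \<open>Y\<close> is an ordinary smooth curve, and the section through the prescribed point
    \<open>z\<close> carries it back to \<open>Z\<close>.\<close>
  have lift: "\<exists>D'\<in>tangent (embedded Z) z. push Q \<pi> D' = D" if "z \<in> Z" "D \<in> tangent Q (\<pi> z)" for z D
  proof -
    from that(2) obtain \<gamma> where \<gamma>: "smooth_curve Q \<gamma>" "\<gamma> 0 = \<pi> z" "D = velocity Q \<gamma>"
      by (auto simp: tangent_def)
    have "smooth_curve (embedded Y) (\<phi> \<circ> \<gamma>)"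
      by (rule smooth_curve_push[OF _ _ \<gamma>(1)]) (use pull\<phi> bij in \<open>auto simp: bij_betw_def\<close>)
    then obtain e where e: "e > 0" "(\<phi> \<circ> \<gamma>) ` {-e<..<e} \<subseteq> Y" "smooth_on {-e<..<e} (\<phi> \<circ> \<gamma>)"
      by (auto simp: smooth_curve_embedded_iff)
    from sect[OF that(1)] obtain U s where s: "open U" "\<Phi> z \<in> U" "smooth_on U s" "s (\<Phi> z) = z"
      "\<And>y. y \<in> U \<inter> Y \<Longrightarrow> s y \<in> Z \<and> \<Phi> (s y) = y" by blast
    \<comment> \<open>The times at which the image curve lies in the domain of the section; an
      interval around \<open>0\<close> inside \<open>V\<close> carries the lifted curve.\<close>
    define V where "V = (\<phi> \<circ> \<gamma>) -` U \<inter> {-e<..<e}"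
    have "open V"
      using continuous_on_open_vimage[OF open_greaterThanLessThan, of "-e" e "\<phi> \<circ> \<gamma>"] smooth_on_imp_continuous_on[OF e(3)] s(1)
      unfolding V_def by blast
    moreover have "0 \<in> V" using e(1) \<gamma>(2) \<phi>[OF that(1)] s(2) by (simp add: V_def)
    ultimately obtain e' where e': "e' > 0" "ball 0 e' \<subseteq> V"
      using open_contains_ball by blast
    have ball: "ball 0 e' = {-e'<..<e'}" by (auto simp: dist_real_def)
    define \<delta> where "\<delta> = s \<circ> (\<phi> \<circ> \<gamma>)"
    have inV: "\<delta> t \<in> Z \<and> \<Phi> (\<delta> t) = \<phi> (\<gamma> t)" if "t \<in> V" for t
      unfolding \<delta>_def comp_apply using that e(2) by (intro s(5)) (auto simp: V_def)
    have "{-e'<..<e'} \<subseteq> {-e<..<e}" and sub: "(\<phi> \<circ> \<gamma>) ` {-e'<..<e'} \<subseteq> U"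
      using e'(2) unfolding ball V_def by blast+
    then have "smooth_on {-e'<..<e'} (\<phi> \<circ> \<gamma>)"
      using smooth_on_subset[OF e(3)] by blast
    then have "smooth_on {-e'<..<e'} \<delta>"
      unfolding \<delta>_def comp_def[of s]
      by (rule smooth_on_compose[OF open_greaterThanLessThan s(1) sub _ s(3)])
    then have \<delta>: "smooth_curve (embedded Z) \<delta>"
      unfolding smooth_curve_embedded_iff using inV e' ball by blast
    have "\<forall>\<^sub>F t in nhds 0. t \<in> V"
      using \<open>open V\<close> \<open>0 \<in> V\<close> by (rule eventually_nhds_in_open)
    \<comment> \<open>Both orbits have the same image under the injective map \<phi>.\<close>
    with eventually_smooth_curve[OF \<gamma>(1)] have "\<forall>\<^sub>F t in nhds 0. (\<pi> \<circ> \<delta>) t = \<gamma> t"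
    proof eventually_elim
      case (elim t)
      then show ?case using inV[of t] \<phi>[of "\<delta> t"] bij unfolding bij_betw_def inj_on_def
        by (auto simp: Q)
    qed
    then have "push Q \<pi> (velocity (embedded Z) \<delta>) = D"
      using velocity_cong[of "\<pi> \<circ> \<delta>" \<gamma> Q] \<gamma>(3) push\<pi> by simp
    moreover have "\<delta> 0 = z"
      using \<gamma>(2) \<phi>[OF that(1)] s(4) by (simp add: \<delta>_def)
    ultimately show ?thesis
      using \<delta> by (auto simp: tangent_def)
  qed
  have amb\<phi>: "ambient (push (embedded_symp Y \<eta>) \<phi> (push Q \<pi> (velocity (embedded Z) \<gamma>)))
      = vector_derivative (\<Phi> \<circ> \<gamma>) (at 0)" if "smooth_curve (embedded Z) \<gamma>" for \<gamma>
  proof -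
    have "\<forall>\<^sub>F t in nhds 0. (\<phi> \<circ> \<pi> \<circ> \<gamma>) t = (\<Phi> \<circ> \<gamma>) t"
      using eventually_smooth_curve[OF that] by eventually_elim (simp add: \<phi>)
    then have "push (embedded_symp Y \<eta>) \<phi> (push Q \<pi> (velocity (embedded Z) \<gamma>))
      = velocity (embedded Y) (\<Phi> \<circ> \<gamma>)"
      using push\<pi> push_velocity[of "embedded_symp Y \<eta>" \<phi> Q] pull\<phi>
        velocity_cong[of "\<phi> \<circ> \<pi> \<circ> \<gamma>" "\<Phi> \<circ> \<gamma>" "embedded Y"]
        velocity_space_cong[of "embedded_symp Y \<eta>" "embedded Y"]
      by (simp add: comp_assoc)
    moreover have "smooth_curve (embedded Y) (\<Phi> \<circ> \<gamma>)"
      by (rule smooth_curve_push[OF pull\<Phi> _ that]) (use \<Phi>(2) in auto)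
    ultimately show ?thesis by (simp add: ambient_velocity)
  qed
  have ambid: "ambient (push M id (velocity (embedded Z) \<gamma>)) = vector_derivative \<gamma> (at 0)"
    if "smooth_curve (embedded Z) \<gamma>" for \<gamma>
  proof -
    have "g \<circ> id \<in> funs (embedded Z)" if "g \<in> funs M" for g
      using that ZX funs_embedded_subset by (auto simp: M_def)
    moreover have "smooth_curve (embedded X) \<gamma>"
      using that ZX by (fastforce simp: smooth_curve_embedded_iff)
    ultimately show ?thesis
      using push_velocity[of M id "embedded Z"] ambient_velocity[of X \<gamma>]
        velocity_space_cong[of M "embedded X"] by (simp add: M_def)
  qed
  have "form (embedded_symp Y \<eta>) (\<phi> c) (push (embedded_symp Y \<eta>) \<phi> D) (push (embedded_symp Y \<eta>) \<phi> E)
      = form R c D E" if "c \<in> pts R" "D \<in> tangent R c" "E \<in> tangent R c" for c D E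
  proof -
    have DE: "D \<in> tangent Q c" "E \<in> tangent Q c"
      using that(2,3) tangent_space_cong[OF R(1,2)] by auto
    from that(1) obtain z where z: "z \<in> Z" "c = \<pi> z" by (auto simp: R Q)
    let ?k = "form (embedded_symp Y \<eta>) (\<phi> c) (push (embedded_symp Y \<eta>) \<phi> D) (push (embedded_symp Y \<eta>) \<phi> E)"
    \<comment> \<open>Uniqueness half of the definite description: \<omega> on the level equals
      \<eta> on the images, which depend only on \<open>c\<close>, \<open>D\<close> and
      \<open>E\<close>.\<close>
    have key: "form M z (push M id D') (push M id E') = ?k"
      if "z \<in> Z" "\<pi> z = c" "D' \<in> tangent (embedded Z) z" "E' \<in> tangent (embedded Z) z"
        "push Q \<pi> D' = D" "push Q \<pi> E' = E" for z D' E'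
    proof -
      from that(3) obtain \<gamma> where \<gamma>: "smooth_curve (embedded Z) \<gamma>" "\<gamma> 0 = z" "D' = velocity (embedded Z) \<gamma>"
        by (auto simp: tangent_def)
      from that(4) obtain \<delta> where \<delta>: "smooth_curve (embedded Z) \<delta>" "\<delta> 0 = z" "E' = velocity (embedded Z) \<delta>"
        by (auto simp: tangent_def)
      have "form M z (push M id D') (push M id E') =
          \<omega> (\<gamma> 0) (vector_derivative \<gamma> (at 0)) (vector_derivative \<delta> (at 0))"
        by (simp only: M_def embedded_symp_simps \<gamma>(2,3) \<delta>(3) ambid[OF \<gamma>(1), unfolded M_def]
            ambid[OF \<delta>(1), unfolded M_def])
      also have "\<dots> = \<eta> (\<Phi> (\<gamma> 0)) (vector_derivative (\<Phi> \<circ> \<gamma>) (at 0)) (vector_derivative (\<Phi> \<circ> \<delta>) (at 0))"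
        by (rule form[OF \<gamma>(1) \<delta>(1)]) (simp only: \<gamma>(2) \<delta>(2))
      also have "\<Phi> (\<gamma> 0) = \<phi> c"
        using \<phi>[OF that(1)] by (simp only: \<gamma>(2) that(2))
      also have "vector_derivative (\<Phi> \<circ> \<gamma>) (at 0) = ambient (push (embedded_symp Y \<eta>) \<phi> D)"
        using amb\<phi>[OF \<gamma>(1)] by (simp only: \<gamma>(3)[symmetric] that(5))
      also have "vector_derivative (\<Phi> \<circ> \<delta>) (at 0) = ambient (push (embedded_symp Y \<eta>) \<phi> E)"
        using amb\<phi>[OF \<delta>(1)] by (simp only: \<delta>(3)[symmetric] that(6))
      finally show ?thesis by (simp only: embedded_symp_simps)
    qed
    \<comment> \<open>Existence half: both vectors are lifted at the same point
      \<open>z\<close>.\<close>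
    from lift[OF z(1), of D] lift[OF z(1), of E] DE z(2)
    obtain D' E' where D': "D' \<in> tangent (embedded Z) z" "E' \<in> tangent (embedded Z) z"
        "push Q \<pi> D' = D" "push Q \<pi> E' = E" by auto
    have "rform c D E = ?k"
      unfolding rform_def
    proof (rule the_equality)
      show "\<exists>z\<in>Z. \<exists>D'\<in>tangent (embedded Z) z. \<exists>E'\<in>tangent (embedded Z) z.
          \<pi> z = c \<and> push Q \<pi> D' = D \<and> push Q \<pi> E' = E \<and> ?k = form M z (push M id D') (push M id E')"
        by (intro bexI[OF _ z(1)] bexI[OF _ D'(1)] bexI[OF _ D'(2)] conjI D'(3,4)
            z(2)[symmetric] key[OF z(1) z(2)[symmetric] D', symmetric])
    qed (elim bexE conjE, simp only: key)
    then show ?thesis by (simp add: R)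
  qed
  then have "symplectomorphism R (embedded_symp Y \<eta>) \<phi>"
    using diffeo R by (auto simp: symplectomorphism_def)
  then show ?thesis using \<phi> by (auto simp: R_def M_def)
qed

section \<open>Quaternions and the Lie--Poisson structure\<close>

lemmas quat_defs = times_quat_def plus_quat_def minus_quat_def uminus_quat_def one_quat_def
  zero_quat_def scaleR_quat_def inner_quat_def cnj_quat_def imq_def

lemma quat_comp_simps [simp]:
  "qre (p + q) = qre p + qre q" "qim (p + q) = qim p + qim q"
  "qre (p - q) = qre p - qre q" "qim (p - q) = qim p - qim q"
  "qre (- p) = - qre p" "qim (- p) = - qim p"
  "qre (c *\<^sub>R p) = c * qre p" "qim (c *\<^sub>R p) = c *\<^sub>R qim p"
  "qre 0 = 0" "qim 0 = 0" "qre 1 = 1" "qim 1 = 0"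
  "qre (cnj_quat p) = qre p" "qim (cnj_quat p) = - qim p"
  "qre (imq x) = 0"
  by (simp_all add: quat_defs)

lemma qim_imq [simp]: "qim (imq x) = x"
  by (simp add: imq_def)

lemma imq_eq_iff: "imq x = imq y \<longleftrightarrow> x = y"
  by (metis qim_imq)

lemma imq_qim: "qre p = 0 \<Longrightarrow> imq (qim p) = p"
  by (simp add: quat_eq_iff)

lemma imq_linear [simp]:
  "imq (x + y) = imq x + imq y" "imq (x - y) = imq x - imq y" "imq (- x) = - imq x"
  "imq (c *\<^sub>R x) = c *\<^sub>R imq x" "imq 0 = 0"
  by (simp_all add: quat_eq_iff)

lemma cnj_simps [simp]:
  "cnj_quat (p + q) = cnj_quat p + cnj_quat q" "cnj_quat (p - q) = cnj_quat p - cnj_quat q"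
  "cnj_quat (- p) = - cnj_quat p" "cnj_quat (c *\<^sub>R p) = c *\<^sub>R cnj_quat p"
  "cnj_quat (cnj_quat p) = p" "cnj_quat (imq x) = - imq x" "cnj_quat 0 = 0" "cnj_quat 1 = 1"
  by (simp_all add: quat_eq_iff)

lemma cnj_mult [simp]: "cnj_quat (p * q) = cnj_quat q * cnj_quat p"
  unfolding quat_eq_iff vec_eq_iff forall_3
  by (simp add: quat_defs cross_components inner_vec_def sum_3 algebra_simps)

lemma qre_mult_commute: "qre (p * q) = qre (q * p)"
  by (simp add: quat_defs inner_commute)

lemma inner_quat_qre: "p \<bullet> q = qre (cnj_quat p * q)"
  by (simp add: quat_defs)

lemma inner_mult_cnj_left: "(a * b) \<bullet> c = b \<bullet> (cnj_quat a * c)" for a b c :: quat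
  by (simp add: inner_quat_qre mult.assoc)

text \<open>Cyclicity of the real part moves the right factor across.\<close>

lemma inner_mult_cnj_right: "(a * b) \<bullet> c = a \<bullet> (c * cnj_quat b)" for a b c :: quat
  unfolding inner_quat_qre cnj_mult mult.assoc
  by (subst qre_mult_commute) (simp add: mult.assoc)

lemma inner_imq [simp]: "imq x \<bullet> imq y = x \<bullet> y"
  by (simp add: quat_defs)

lemma inner_qim: "x \<bullet> qim p = imq x \<bullet> p" "qim p \<bullet> x = p \<bullet> imq x"
  by (simp_all add: quat_defs inner_commute)

lemma cnj_mult_self: "cnj_quat p * p = of_real (p \<bullet> p)" "p * cnj_quat p = of_real (p \<bullet> p)"
  using inner_quat_cnj[of "cnj_quat p" "cnj_quat p"] inner_quat_cnj[of p p]
  by (simp_all add: scaleR_2[symmetric] mult_2[symmetric] inner_quat_def of_real_def)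

lemma S3_cnj [simp]:
  assumes "p \<in> S3"
  shows "cnj_quat p * p = 1" "p * cnj_quat p = 1" "inverse p = cnj_quat p"
    "cnj_quat p * (p * q) = q" "p * (cnj_quat p * q) = q"
proof -
  from assms have n: "p \<bullet> p = 1" by (simp add: norm_eq_1)
  then show 1: "cnj_quat p * p = 1" "p * cnj_quat p = 1" by (simp_all add: cnj_mult_self)
  show "inverse p = cnj_quat p" by (simp add: inverse_quat_def n)
  show "cnj_quat p * (p * q) = q" "p * (cnj_quat p * q) = q"
    by (simp_all add: mult.assoc[symmetric] 1)
qed

lemma norm_cnj [simp]: "norm (cnj_quat p) = norm p"
  by (simp add: norm_eq_sqrt_inner inner_quat_def)

lemma norm_imq [simp]: "norm (imq x) = norm x"
  by (simp add: norm_eq_sqrt_inner)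

lemma S3_closed: "p \<in> S3 \<Longrightarrow> q \<in> S3 \<Longrightarrow> p * q \<in> S3" "p \<in> S3 \<Longrightarrow> cnj_quat p \<in> S3"
  by (simp_all add: norm_mult)

lemma
  shows bounded_linear_cnj: "bounded_linear cnj_quat"
    and bounded_linear_qim: "bounded_linear qim"
    and bounded_linear_imq: "bounded_linear imq"
  by (auto intro!: linearI simp: linear_conv_bounded_linear[symmetric])

lemmas smooth_on_cnj = smooth_on_bounded_linear[OF bounded_linear_cnj]
lemmas smooth_on_qim = smooth_on_bounded_linear[OF bounded_linear_qim]
lemmas smooth_on_imq = smooth_on_bounded_linear[OF bounded_linear_imq]

lemma imq_comm: "imq (comm x y) = imq x * imq y - imq y * imq x"
  unfolding comm_def by (rule imq_qim) (simp add: qre_mult_commute)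

text \<open>Invariance of the inner product under the adjoint action of \<open>Im H\<close>; it
  makes the transpose of a bracket a bracket again.\<close>

lemma inner_comm: "comm x y \<bullet> z = y \<bullet> comm z x"
  unfolding inner_imq[symmetric] imq_comm
  by (simp add: inner_diff_left inner_diff_right inner_mult_cnj_left[of "imq x"]
      inner_mult_cnj_right[of "imq y" "imq x"])

section \<open>Infinitesimal coadjoint action and the Kirillov--Kostant--Souriau form\<close>

text \<open>Imaginary quaternions act skewly on either side, and the terms with \<open>u\<close>
  move into the first two slots by conjugate multiplication. The resulting transpose of the bracket
  is its adjoint by uniqueness.\<close>

lemma S_coad_eq:
  "S_coad (x, y, u) (A1, A2, g) =
    (comm A1 x - qim (g * cnj_quat u), comm A2 y + qim (cnj_quat u * g), g * imq y - imq x * g)"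
proof -
  let ?f = "\<lambda>(A1, A2, g). (comm A1 x - qim (g * cnj_quat u), comm A2 y + qim (cnj_quat u * g),
      g * imq y - imq x * g)"
  have "S_bracket (x, y, u) \<zeta> \<bullet> \<mu> = \<zeta> \<bullet> ?f \<mu>" for \<zeta> \<mu>
  proof -
    obtain x' y' u' where \<zeta>: "\<zeta> = (x', y', u')" by (cases \<zeta>)
    obtain A1 A2 g where \<mu>: "\<mu> = (A1, A2, g)" by (cases \<mu>)
    have "(imq x * u') \<bullet> g = - (u' \<bullet> (imq x * g))" "(u' * imq y) \<bullet> g = - (u' \<bullet> (g * imq y))"
      "(imq x' * u) \<bullet> g = x' \<bullet> qim (g * cnj_quat u)" "(u * imq y') \<bullet> g = y' \<bullet> qim (cnj_quat u * g)"
      by (simp_all add: inner_mult_cnj_left[of "imq x"] inner_mult_cnj_right[of u'] inner_qim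
          inner_mult_cnj_right[of "imq x'"] inner_mult_cnj_left[of u])
    then show ?thesis
      by (simp add: \<zeta> \<mu> inner_Pair inner_comm inner_diff_left inner_diff_right inner_add_right)
  qed
  then have "S_coad (x, y, u) = ?f"
    unfolding S_coad_def by (intro adjoint_unique) auto
  then show ?thesis by simp
qed

lemma S_bracket_inner: "\<mu> \<bullet> S_bracket \<xi> \<eta> = S_coad \<xi> \<mu> \<bullet> \<eta>"
proof -
  obtain x y u where \<xi>: "\<xi> = (x, y, u)" by (cases \<xi>)
  obtain x' y' u' where \<eta>: "\<eta> = (x', y', u')" by (cases \<eta>)
  have "linear (S_bracket \<xi>)"
    unfolding \<xi> by (rule linearI) (auto simp: comm_def algebra_simps split: prod.splits)
  then show ?thesis
    unfolding S_coad_def by (metis adjoint_works inner_commute)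
qed

lemma S_bracket_swap: "S_bracket \<xi> \<eta> = - S_bracket \<eta> \<xi>"
  by (cases \<xi>; cases \<eta>) (simp add: comm_def)

text \<open>The definite description is unambiguous: the pairing depends on \<xi> only through
  \<open>S_coad \<xi> \<mu>\<close>, and by antisymmetry the same holds for \<eta>.\<close>

lemma kks_form_coad:
  "kks_form \<sigma> \<mu> (S_coad \<xi> \<mu>) (S_coad \<eta> \<mu>) = \<sigma> * (\<mu> \<bullet> S_bracket \<xi> \<eta>)"
  unfolding kks_form_def
proof (rule the_equality)
  fix r assume "\<exists>\<xi>' \<eta>'. S_coad \<xi> \<mu> = S_coad \<xi>' \<mu> \<and> S_coad \<eta> \<mu> = S_coad \<eta>' \<mu> \<and>
      r = \<sigma> * (\<mu> \<bullet> S_bracket \<xi>' \<eta>')"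
  then obtain \<xi>' \<eta>' where eq: "S_coad \<xi> \<mu> = S_coad \<xi>' \<mu>" "S_coad \<eta> \<mu> = S_coad \<eta>' \<mu>"
    and r: "r = \<sigma> * (\<mu> \<bullet> S_bracket \<xi>' \<eta>')" by blast
  have "\<mu> \<bullet> S_bracket \<xi>' \<eta>' = \<mu> \<bullet> S_bracket \<xi> \<eta>'"
    by (simp only: S_bracket_inner eq)
  also have "\<dots> = - (\<mu> \<bullet> S_bracket \<eta>' \<xi>)"
    by (subst S_bracket_swap) simp
  also have "\<dots> = - (\<mu> \<bullet> S_bracket \<eta> \<xi>)"
    by (simp only: S_bracket_inner eq)
  also have "\<dots> = \<mu> \<bullet> S_bracket \<xi> \<eta>"
    by (subst S_bracket_swap) simp
  finally show "r = \<sigma> * (\<mu> \<bullet> S_bracket \<xi> \<eta>)" by (simp only: r)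
qed blast

section \<open>Gradients and the Casimir functions\<close>

text \<open>The gradient is a definite description; the vector with coordinates \<open>f' b\<close>
  represents the derivative and is the only one that does.\<close>

lemma inner_grad:
  fixes f :: "'a::euclidean_space \<Rightarrow> real"
  assumes "(f has_derivative f') (at x)"
  shows "grad f x \<bullet> w = f' w"
proof -
  interpret f': linear f' using assms by (rule has_derivative_linear)
  let ?D = "\<Sum>b\<in>Basis. f' b *\<^sub>R b"
  have D: "v \<bullet> ?D = f' v" for v
  proof -
    have "f' v = f' (\<Sum>b\<in>Basis. (v \<bullet> b) *\<^sub>R b)" by (simp only: euclidean_representation)
    also have "\<dots> = (\<Sum>b\<in>Basis. (v \<bullet> b) *\<^sub>R f' b)" by (simp only: f'.sum f'.scaleR)
    finally show ?thesis by (simp add: inner_sum_right mult.commute)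
  qed
  have "GDERIV f x :> ?D"
    using assms unfolding gderiv_def D .
  moreover have "E = ?D" if "GDERIV f x :> E" for E
  proof -
    have "h \<bullet> E = h \<bullet> ?D" for h
      unfolding D using has_derivative_unique[OF that[unfolded gderiv_def] assms] by metis
    then show ?thesis using vector_eq_ldot by blast
  qed
  ultimately have "grad f x = ?D"
    unfolding grad_def by (rule the_equality)
  then show ?thesis using D by (simp add: inner_commute)
qed

text \<open>Up to the factor \<open>- \<sigma>\<close>, the bracket of \<open>C\<close> with
  \<open>h\<close> is the derivative of \<open>C\<close> in the coadjoint direction of
  \<open>grad h \<mu>\<close>.\<close>

lemma casimirI:
  assumes "smooth_on UNIV C" "\<And>\<mu>. (C has_derivative C' \<mu>) (at \<mu>)"
    and "\<And>\<mu> \<zeta>. C' \<mu> (S_coad \<zeta> \<mu>) = 0"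
  shows "casimir \<sigma> C"
  unfolding casimir_def
proof (intro conjI allI impI)
  fix h \<mu>
  have "\<mu> \<bullet> S_bracket (grad C \<mu>) (grad h \<mu>) = - (S_coad (grad h \<mu>) \<mu> \<bullet> grad C \<mu>)"
    unfolding S_bracket_inner[symmetric] by (subst S_bracket_swap) simp
  also have "\<dots> = 0"
    using inner_grad[OF assms(2), of \<mu> "S_coad (grad h \<mu>) \<mu>"] assms(3)
    by (simp add: inner_commute)
  finally show "lie_poisson \<sigma> C h \<mu> = 0" by (simp add: lie_poisson_S_bracket)
qed (rule assms)

text \<open>After \<open>v\<close> is moved across, a real quaternion is paired with an imaginary
  one. Infinitesimal left and right rotations therefore preserve the norm.\<close>

lemma inner_infinitesimal_rotation: "v \<bullet> (v * imq y - imq x * v) = 0"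
proof -
  have "(v * imq y) \<bullet> v = 0" "(imq x * v) \<bullet> v = 0"
    unfolding inner_mult_cnj_left[of v] inner_mult_cnj_right[of _ v] cnj_mult_self
    by (simp_all add: of_real_def inner_quat_def)
  then show ?thesis by (simp add: inner_diff_right inner_commute)
qed

lemma C1_alt: "C1 \<mu> = snd (snd \<mu>) \<bullet> snd (snd \<mu>)"
  by (cases \<mu>) (simp add: power2_norm_eq_inner)

text \<open>The quaternion whose squared norm is \<open>C2\<close>, written with projections rather
  than patterns so that the rules for smoothness and derivatives apply.\<close>

definition twist :: "salg \<Rightarrow> quat" where
  "twist \<mu> = imq (fst \<mu>) * snd (snd \<mu>) + snd (snd \<mu>) * imq (fst (snd \<mu>))"

lemma C2_alt: "C2 \<mu> = twist \<mu> \<bullet> twist \<mu>"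
  by (cases \<mu>) (simp add: power2_norm_eq_inner twist_def)

lemmas smooth_on_quat_intros = smooth_on_Pair smooth_on_add smooth_on_diff smooth_on_mult
  smooth_on_inner smooth_on_cnj smooth_on_qim smooth_on_imq smooth_on_fst smooth_on_snd
  smooth_on_const smooth_on_ident open_UNIV

lemma casimir_C1: "casimir \<sigma> C1"
proof (rule casimirI)
  show "smooth_on UNIV C1"
    unfolding C1_alt[abs_def] by (intro smooth_on_quat_intros)
  show "(C1 has_derivative (\<lambda>w. 2 * (snd (snd \<mu>) \<bullet> snd (snd w)))) (at \<mu>)" for \<mu>
    unfolding C1_alt[abs_def]
    by (auto intro!: derivative_eq_intros simp: inner_commute)
  show "2 * (snd (snd \<mu>) \<bullet> snd (snd (S_coad \<zeta> \<mu>))) = 0" for \<mu> \<zeta>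
    by (cases \<mu>; cases \<zeta>) (simp add: S_coad_eq inner_infinitesimal_rotation)
qed

lemma imq_qim_eq: "imq (qim p) = p - of_real (qre p)"
  by (simp add: quat_eq_iff of_real_def)

lemma of_real_quat_commute: "of_real r * p = p * of_real r" for p :: quat
  by (simp add: of_real_def)

lemma casimir_C2: "casimir \<sigma> C2"
proof (rule casimirI)
  show "smooth_on UNIV C2"
    unfolding C2_alt[abs_def] twist_def by (intro smooth_on_quat_intros)
  let ?dt = "\<lambda>\<mu> w. imq (fst w) * snd (snd \<mu>) + imq (fst \<mu>) * snd (snd w) +
    (snd (snd w) * imq (fst (snd \<mu>)) + snd (snd \<mu>) * imq (fst (snd w)))"
  show "(C2 has_derivative (\<lambda>w. 2 * (twist \<mu> \<bullet> ?dt \<mu> w))) (at \<mu>)" for \<mu>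
  proof -
    have "(twist has_derivative ?dt \<mu>) (at \<mu>)"
      unfolding twist_def[abs_def]
      by (auto intro!: derivative_eq_intros bounded_linear.has_derivative[OF bounded_linear_imq])
    from has_derivative_inner[OF this this] show ?thesis
      unfolding C2_alt[abs_def] by (rule has_derivative_eq_rhs) (simp add: fun_eq_iff inner_commute)
  qed
  show "2 * (twist \<mu> \<bullet> ?dt \<mu> (S_coad \<zeta> \<mu>)) = 0" for \<mu> \<zeta>
  proof -
    obtain A1 A2 g where \<mu>: "\<mu> = (A1, A2, g)" by (cases \<mu>)
    obtain x y u where \<zeta>: "\<zeta> = (x, y, u)" by (cases \<zeta>)
    \<comment> \<open>Along a coadjoint direction \<open>twist\<close> itself undergoes an
      infinitesimal rotation. The terms with \<open>u\<close> cancel, since the real parts removed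
      by \<open>qim\<close> agree by cyclicity and commute with everything.\<close>
    have "?dt \<mu> (S_coad \<zeta> \<mu>) = twist \<mu> * imq y - imq x * twist \<mu>"
      by (simp add: \<mu> \<zeta> S_coad_eq twist_def imq_comm imq_qim_eq algebra_simps of_real_quat_commute
          qre_mult_commute[of g])
    then show ?thesis
      by (simp only: inner_infinitesimal_rotation mult_zero_right)
  qed
qed

section \<open>Coadjoint orbits\<close>

lemma imq_square: "imq x * imq x = - of_real (x \<bullet> x)"
proof -
  have "- (imq x * imq x) = of_real (x \<bullet> x)"
    using cnj_mult_self(1)[of "imq x"] by simp
  then show ?thesis by (metis minus_minus)
qed

text \<open>Any nonzero intertwiner can be normalized. Since \<open>m\<close> and \<open>n\<close>
  have the same square, their sum is one. If \<open>n = - m\<close> the sum vanishes, but a nonzero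
  imaginary quaternion orthogonal to \<open>m\<close> anticommutes with it and serves
  instead.\<close>

lemma S3_rotation:
  assumes "norm m = norm n"
  shows "\<exists>a\<in>S3. a * imq m = imq n * a"
proof -
  have *: "\<exists>a\<in>S3. a * imq m = imq n * a" if "p \<noteq> 0" "p * imq m = imq n * p" for p
    using that by (intro bexI[of _ "sgn p"]) (simp_all add: norm_sgn sgn_div_norm)
  show ?thesis
  proof (cases "imq n + imq m = 0")
    case False
    have "(imq n + imq m) * imq m = imq n * (imq n + imq m)"
      using assms by (simp add: distrib_left distrib_right imq_square norm_eq)
    with * False show ?thesis by blast
  next
    case True
    then have n: "imq n = - imq m" by (simp add: eq_neg_iff_add_eq_0)
    show ?thesis
    proof (cases "m = 0")
      case True
      with n show ?thesis by (intro bexI[of _ 1]) simp_all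
    next
      case False
      obtain y :: "real^3" where y: "y \<noteq> 0" "orthogonal m y"
        using orthogonal_to_vector_exists[of m] by auto
      have "imq y * imq m = - (imq m * imq y)"
        using y(2) cross_skew[of m y]
        by (simp add: orthogonal_def quat_eq_iff quat_defs inner_commute)
      moreover have "imq y \<noteq> 0" using y(1) by (metis norm_imq norm_eq_zero)
      ultimately show ?thesis using * n by simp
    qed
  qed
qed

text \<open>The quaternion \<open>g - lam g n / |lam|\<^sup>2\<close> conjugates \<open>n\<close> to \<open>lam\<close> and equals \<open>2 g\<close> if \<open>g\<close> already does;
  for \<open>lam = 0\<close> it is \<open>g\<close> by the convention \<open>1 / 0 = 0\<close>.\<close>

lemma smooth_local_rotation:
  assumes lam: "qre lam = 0" and g: "g \<in> S3" "g * n0 = lam * g"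
  shows "\<exists>U r. open U \<and> n0 \<in> U \<and> smooth_on U r \<and> r n0 = g \<and>
    (\<forall>n\<in>U. qre n = 0 \<longrightarrow> norm n = norm lam \<longrightarrow> r n \<in> S3 \<and> r n * n = lam * r n)"
proof -
  define p where "p n = g - (lam * g * n) /\<^sub>R (lam \<bullet> lam)" for n
  have sq: "m * m = - of_real (m \<bullet> m)" if "qre m = 0" for m
    using that imq_square[of "qim m"] imq_qim[of m] by (metis inner_imq)
  have p0: "p n0 = (if lam = 0 then g else 2 *\<^sub>R g)"
    using g(2) sq[OF lam] by (simp add: p_def mult.assoc) (simp add: mult.assoc[symmetric] scaleR_2 of_real_def)
  have smooth: "smooth_on V p" if "open V" for V
    unfolding p_def[abs_def]
    by (intro smooth_on_diff smooth_on_scaleR smooth_on_mult smooth_on_const smooth_on_ident that)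
  \<comment> \<open>On this open set \<open>p\<close> can be normalized smoothly; it contains
    \<open>n0\<close> because \<open>p n0\<close> is \<open>g\<close> or twice
    \<open>g\<close>.\<close>
  define U where "U = {n. p n \<noteq> 0}"
  have U: "open U"
    using smooth_on_imp_continuous_on[OF smooth[OF open_UNIV]] unfolding U_def
    by (intro open_Collect_neq continuous_on_const) 
  have "sgn (p n) \<in> S3 \<and> sgn (p n) * n = lam * sgn (p n)"
    if "n \<in> U" "qre n = 0" "norm n = norm lam" for n
  proof -
    have "n \<bullet> n = lam \<bullet> lam" using that(3) by (simp add: norm_eq)
    \<comment> \<open>For nonzero \<open>lam\<close> both sides equal
      \<open>g * n + lam * g\<close>, because \<open>n\<close> and \<open>lam\<close> have the same
      square; for \<open>lam = 0\<close> the norm forces \<open>n = 0\<close>.\<close>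
    have "p n * n = lam * p n"
    proof (cases "lam = 0")
      case True
      then show ?thesis using that(3) by simp
    next
      case False
      then show ?thesis
        using sq[OF lam] sq[OF that(2)] \<open>n \<bullet> n = lam \<bullet> lam\<close>
        by (simp add: p_def left_diff_distrib right_diff_distrib mult.assoc)
          (simp add: mult.assoc[symmetric] of_real_def)
    qed
    then show ?thesis
      using that(1) by (simp add: U_def norm_sgn sgn_div_norm)
  qed
  moreover have "smooth_on U (\<lambda>n. sgn (p n))"
    by (rule smooth_on_sgn[OF U smooth[OF U]]) (simp add: U_def)
  moreover have "n0 \<in> U" "sgn (p n0) = g"
    using g(1) by (auto simp: U_def p0 sgn_div_norm)
  ultimately show ?thesis
    using U by (intro exI[of _ U] exI[of _ "\<lambda>n. sgn (p n)"]) blast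
qed

text \<open>For a unit quaternion this is the adjoint action on \<open>Im H\<close>. The conjugate
  in place of the inverse makes it polynomial, hence smooth everywhere.\<close>

definition rot :: "quat \<Rightarrow> real^3 \<Rightarrow> real^3" where
  "rot g x = qim (g * imq x * cnj_quat g)"

text \<open>The product changes sign under quaternion conjugation, so \<open>qim\<close> discards no
  real part.\<close>

lemma imq_rot: "imq (rot g x) = g * imq x * cnj_quat g"
  unfolding rot_def
proof (rule imq_qim)
  have "cnj_quat (g * imq x * cnj_quat g) = - (g * imq x * cnj_quat g)" by (simp add: mult.assoc)
  then show "qre (g * imq x * cnj_quat g) = 0"
    using quat_comp_simps(5,13) equal_neg_zero by metis
qed

lemma rot_qim: "g \<in> S3 \<Longrightarrow> rot g (qim p) = qim (g * p * cnj_quat g)"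
  by (simp add: rot_def imq_qim_eq right_diff_distrib left_diff_distrib of_real_def)

text \<open>The factor \<open>g\<close> comes out on the right of the twisted sum and has norm
  one.\<close>

lemma C2_rot: "g \<in> S3 \<Longrightarrow> C2 (A1, A2, g) = (norm (A1 + rot g A2))\<^sup>2"
proof -
  assume g: "g \<in> S3"
  then have "imq A1 * g + g * imq A2 = imq (A1 + rot g A2) * g"
    by (simp add: imq_rot distrib_right mult.assoc)
  then show ?thesis using g by (simp add: norm_mult del: imq_linear)
qed

lemma casimir_level_iff:
  "(A1, A2, g) \<in> casimir_level c \<longleftrightarrow> g \<in> S3 \<and> (norm (A1 + rot g A2))\<^sup>2 = c"
proof -
  have "C1 (A1, A2, g) = 1 \<longleftrightarrow> g \<in> S3"
    using norm_ge_zero[of g] by (auto simp: power2_eq_1_iff simp del: norm_ge_zero)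
  then show ?thesis unfolding casimir_level_def using C2_rot by auto
qed

section \<open>The coadjoint action of the group and its orbits\<close>

lemma S_Ad_eq:
  assumes "a \<in> S3" "b \<in> S3"
  shows "S_Ad (a, b, q) (x, y, u) = (rot a x, rot b y,
    a * u * cnj_quat b - imq (rot a x) * q + q * imq (rot b y))"
proof -
  let ?f = "\<lambda>x. S_mult (S_mult (a, b, q) x) (S_inv (a, b, q))"
  have b: "b \<noteq> 0" using assms by auto
  have f: "?f = (\<lambda>x. (a * fst x * inverse a, b * fst (snd x) * inverse b,
      q + a * snd (snd x) * inverse b + a * fst x * (- (inverse a * q * b)) * inverse (b * fst (snd x))))"
    by (auto simp: fun_eq_iff)
  \<comment> \<open>The inverted factor in the last component contributes the derivative of the
    inverse, which becomes the term \<open>q * imq (rot b y)\<close>.\<close>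
  have "(?f has_derivative (\<lambda>w. (a * fst w * inverse a, b * fst (snd w) * inverse b,
      a * snd (snd w) * inverse b + (a * 1 * (- (inverse a * q * b)) *
          (- (inverse (b * 1) * (b * fst (snd w)) * inverse (b * 1))) +
        a * fst w * (- (inverse a * q * b)) * inverse (b * 1))))) (at S_one)"
    unfolding f using b
    by (auto intro!: derivative_eq_intros simp: S_one_def)
  from frechet_derivative_at[OF this, symmetric] show ?thesis
    unfolding S_Ad_def using assms
    by (simp add: rot_def[symmetric]) (simp add: imq_rot mult.assoc)
qed

text \<open>Rotations and multiplications by unit quaternions transpose to their inverses, which
  undoes the inversion of the group element; the terms in \<open>q\<close> move into the first two
  components.\<close>

lemma S_coAd_eq:
  assumes "a \<in> S3" "b \<in> S3"
  shows "S_coAd (a, b, q) (A1, A2, g) =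
    (rot a A1 + qim (a * g * cnj_quat b * cnj_quat q),
     rot b A2 - qim (cnj_quat q * (a * g * cnj_quat b)), a * g * cnj_quat b)"
proof -
  let ?F = "\<lambda>(A1, A2, g). (rot a A1 + qim (a * g * cnj_quat b * cnj_quat q),
     rot b A2 - qim (cnj_quat q * (a * g * cnj_quat b)), a * g * cnj_quat b)"
  have "S_Ad (S_inv (a, b, q)) \<zeta> \<bullet> \<mu> = \<zeta> \<bullet> ?F \<mu>" for \<zeta> \<mu>
  proof -
    obtain x y u where \<zeta>: "\<zeta> = (x, y, u)" by (cases \<zeta>)
    obtain A1 A2 g where \<mu>: "\<mu> = (A1, A2, g)" by (cases \<mu>)
    have rot: "rot (cnj_quat k) z \<bullet> A = z \<bullet> rot k A" for k z A
      unfolding inner_imq[symmetric] imq_rot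
      by (simp add: mult.assoc inner_mult_cnj_left[of "cnj_quat k"] inner_mult_cnj_right[of "imq z"])
    have "(cnj_quat a * u * b) \<bullet> g = u \<bullet> (a * g * cnj_quat b)"
      by (simp add: mult.assoc inner_mult_cnj_left[of "cnj_quat a"] inner_mult_cnj_right[of u])
    moreover have "(imq (rot (cnj_quat a) x) * (cnj_quat a * q * b)) \<bullet> g =
        x \<bullet> qim (a * g * cnj_quat b * cnj_quat q)"
      using assms by (simp add: imq_rot inner_qim mult.assoc inner_mult_cnj_left[of "cnj_quat a"]
          inner_mult_cnj_right[of "imq x"])
    moreover have "(cnj_quat a * q * b * imq (rot (cnj_quat b) y)) \<bullet> g =
        y \<bullet> qim (cnj_quat q * (a * g * cnj_quat b))"
      using assms by (simp add: imq_rot inner_qim mult.assoc inner_mult_cnj_left[of "cnj_quat a"]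
          inner_mult_cnj_left[of q] inner_mult_cnj_right[of "imq y"])
    ultimately show ?thesis
      using S_Ad_eq[OF S3_closed(2)[OF assms(1)] S3_closed(2)[OF assms(2)]] assms
      by (simp add: \<zeta> \<mu> rot inner_add_left inner_add_right inner_diff_left inner_diff_right)
  qed
  then have "S_coAd (a, b, q) = ?F"
    unfolding S_coAd_def by (intro adjoint_unique) auto
  then show ?thesis by simp
qed

lemma coadjoint_orbit_casimir_level:
  assumes "c \<ge> 0"
  shows "coadjoint_orbit (casimir_level c)"
proof -
  \<comment> \<open>The level is the orbit of \<open>(m, 0, 1)\<close>, which lies on it when
    \<open>norm m\<close> is \<open>sqrt c\<close>.\<close>
  obtain m :: "real^3" where m: "norm m = sqrt c"
    using vector_choose_size[of "sqrt c"] assms by auto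
  have "(\<lambda>s. S_coAd s (m, 0, 1)) ` S_carrier = casimir_level c"
  proof (intro equalityI subsetI)
    fix \<mu> assume "\<mu> \<in> (\<lambda>s. S_coAd s (m, 0, 1)) ` S_carrier"
    then obtain a b q where ab: "a \<in> S3" "b \<in> S3" and \<mu>: "\<mu> = S_coAd (a, b, q) (m, 0, 1)"
      by (auto simp: S_carrier_def)
    let ?G = "a * cnj_quat b"
    have G: "?G \<in> S3" by (intro S3_closed ab)
    \<comment> \<open>The translation \<open>q\<close> contributes opposite terms to
      \<open>A1\<close> and to the rotated \<open>A2\<close>, so the sum measured by
      \<open>C2\<close> is just the rotated \<open>m\<close>.\<close>
    have "rot h (qim (cnj_quat q * h)) = qim (h * cnj_quat q)" if "h \<in> S3" for h
      using rot_qim[OF that, of "cnj_quat q * h"] that by (simp add: mult.assoc)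
    from this[OF G] have "rot ?G (qim (cnj_quat q * ?G)) = qim (?G * cnj_quat q)" .
    moreover have "rot k (- x) = - rot k x" "rot b 0 = 0" for k x
      by (simp_all add: rot_def algebra_simps)
    moreover have "norm (rot a m) = norm m"
      using ab by (simp add: norm_imq[symmetric] imq_rot norm_mult del: norm_imq)
    ultimately show "\<mu> \<in> casimir_level c"
      using G ab assms by (simp add: \<mu> S_coAd_eq casimir_level_iff m)
  next
    fix \<mu> assume *: "\<mu> \<in> casimir_level c"
    obtain A1 A2 g where \<mu>: "\<mu> = (A1, A2, g)" by (cases \<mu>)
    with * have g: "g \<in> S3" and n: "norm (A1 + rot g A2) = norm m"
      using m assms by (auto simp: casimir_level_iff)
    obtain a where a: "a \<in> S3" "a * imq m = imq (A1 + rot g A2) * a"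
      using S3_rotation[OF n[symmetric]] by blast
    have "imq (rot a m) = imq (A1 + rot g A2)"
      unfolding imq_rot a(2) using a(1) by (simp add: mult.assoc)
    then have r: "rot a m = A1 + rot g A2" by (simp only: imq_eq_iff)
    \<comment> \<open>\<open>a\<close> turns \<open>m\<close> into \<open>A1 + rot g A2\<close>,
      \<open>cnj_quat g * a\<close> makes the last component \<open>g\<close>, and the translation
      \<open>g * imq A2\<close> takes \<open>rot g A2\<close> out of the first component and puts
      \<open>A2\<close> into the second.\<close>
    have "S_coAd (a, cnj_quat g * a, g * imq A2) (m, 0, 1) = \<mu>"
      unfolding S_coAd_eq[OF a(1) S3_closed(1)[OF S3_closed(2)[OF g] a(1)]] r
      using a(1) g by (simp add: \<mu> rot_def mult.assoc)
    then show "\<mu> \<in> (\<lambda>s. S_coAd s (m, 0, 1)) ` S_carrier"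
      using a(1) g S3_closed by (intro image_eqI[of _ _ "(a, cnj_quat g * a, g * imq A2)"]) (auto simp: S_carrier_def norm_mult)
  qed
  then show ?thesis unfolding coadjoint_orbit_def by metis
qed

section \<open>Diffeomorphism types of the Casimir levels\<close>

lemma smooth_on_rot:
  "open U \<Longrightarrow> smooth_on U f \<Longrightarrow> smooth_on U h \<Longrightarrow> smooth_on U (\<lambda>x. rot (f x) (h x))"
  unfolding rot_def by (intro smooth_on_quat_intros)

text \<open>The shear to \<open>(A1 + rot g A2, A2, g)\<close> turns the level into a sphere of
  radius \<open>sqrt c\<close> times the free \<open>A2\<close> and the unit \<open>g\<close>;
  scaling makes the radius one.\<close>

lemma diffeomorphic_casimir_level_pos:
  assumes "c > 0"
  shows "diffeomorphic (embedded (casimir_level c))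
    (embedded (sphere (0 :: real^3) 1 \<times> (UNIV :: (real^3) set) \<times> S3))"
  unfolding diffeomorphic_def
proof (rule exI, rule diffeo_embedded)
  let ?F = "\<lambda>\<mu>::salg. ((1 / sqrt c) *\<^sub>R (fst \<mu> + rot (snd (snd \<mu>)) (fst (snd \<mu>))), fst (snd \<mu>), snd (snd \<mu>))"
  let ?G = "\<lambda>\<mu>::salg. (sqrt c *\<^sub>R fst \<mu> - rot (snd (snd \<mu>)) (fst (snd \<mu>)), fst (snd \<mu>), snd (snd \<mu>))"
  show "smooth_on UNIV ?F" "smooth_on UNIV ?G"
    by (intro smooth_on_quat_intros smooth_on_rot smooth_on_scaleR)+
  show "?F x \<in> sphere 0 1 \<times> UNIV \<times> S3 \<and> ?G (?F x) = x" if "x \<in> casimir_level c" for x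
  proof -
    obtain A1 A2 g where x: "x = (A1, A2, g)" by (cases x)
    from that[unfolded x casimir_level_iff] have "norm (A1 + rot g A2) = sqrt c"
      by (metis norm_ge_zero real_sqrt_unique)
    with that assms show ?thesis by (simp add: x casimir_level_iff)
  qed
  show "?G y \<in> casimir_level c \<and> ?F (?G y) = y" if "y \<in> sphere 0 1 \<times> UNIV \<times> S3" for y
    using that assms by (cases y) (simp add: casimir_level_iff power_mult_distrib)
qed

text \<open>In the shear coordinates the sphere shrinks to a point, so
  \<open>A1 = - rot g A2\<close> is determined by the other components.\<close>

lemma diffeomorphic_casimir_level_zero:
  "diffeomorphic (embedded (casimir_level 0)) (embedded ((UNIV :: (real^3) set) \<times> S3))"
  unfolding diffeomorphic_def
proof (rule exI, rule diffeo_embedded)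
  let ?G = "\<lambda>y. (0 - rot (snd y) (fst y), fst y, snd y)"
  show "smooth_on UNIV ?G" "smooth_on UNIV (\<lambda>\<mu>::salg. (fst (snd \<mu>), snd (snd \<mu>)))"
    by (intro smooth_on_quat_intros smooth_on_rot)+
qed (auto simp: casimir_level_iff eq_neg_iff_add_eq_0[symmetric])

section \<open>Reduction of the 2-body phase space\<close>

lemma vector_derivative_compose_curve:
  fixes F :: "'a::euclidean_space \<Rightarrow> 'b::real_normed_vector"
  assumes "smooth_curve (embedded X) \<gamma>" "(F has_derivative F') (at (\<gamma> 0))"
  shows "vector_derivative (F \<circ> \<gamma>) (at 0) = F' (vector_derivative \<gamma> (at 0))"
proof -
  have "(F \<circ> \<gamma> has_derivative (\<lambda>t. F' (t *\<^sub>R vector_derivative \<gamma> (at 0)))) (at 0)"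
    using has_derivative_compose[OF smooth_curve_embedded_differentiable[OF assms(1),
          unfolded has_vector_derivative_def] assms(2)] by (simp only: o_def)
  then have "(F \<circ> \<gamma> has_vector_derivative F' (vector_derivative \<gamma> (at 0))) (at 0)"
    unfolding has_vector_derivative_def
    by (rule has_derivative_eq_rhs) (simp add: linear_cmul[OF has_derivative_linear[OF assms(2)]])
  then show ?thesis by (rule vector_derivative_at)
qed

text \<open>Applied to the constraints and to the momentum map, this yields the linear equations on
  the velocity.\<close>

lemma derivative_constant_along_curve:
  fixes F :: "'a::euclidean_space \<Rightarrow> 'b::real_normed_vector"
  assumes "smooth_curve (embedded X) \<gamma>" "(F has_derivative F') (at (\<gamma> 0))"
    and "\<And>x. x \<in> X \<Longrightarrow> F x = c"
  shows "F' (vector_derivative \<gamma> (at 0)) = 0"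
proof -
  have "\<forall>\<^sub>F t in nhds 0. (\<lambda>t. c) t = (F \<circ> \<gamma>) t"
    using eventually_smooth_curve[OF assms(1)] by eventually_elim (simp add: assms(3))
  then have "vector_derivative (\<lambda>t. c) (at 0) = vector_derivative (F \<circ> \<gamma>) (at 0)"
    by (intro vector_derivative_cong_eq) auto
  then show ?thesis
    using vector_derivative_compose_curve[OF assms(1,2)] by simp
qed

text \<open>The Lie algebra element \<open>(x, y, imq b1 * g)\<close> generates the first tangent
  vector: as \<open>g\<close> is a unit, its translation part adds \<open>b1\<close> to the first
  component, and the hypothesis on \<open>b2\<close> says exactly what it adds to the second. The
  form is then the pairing with a bracket.\<close>

lemma kks_form_orbit:
  assumes g: "g \<in> S3" and b2: "imq b2 = - (cnj_quat g * imq b1 * g)"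
    and b2': "imq b2' = - (cnj_quat g * imq b1' * g)"
  shows "kks_form \<sigma> (A1, A2, g)
      (comm A1 x + b1, comm A2 y + b2, g * imq y - imq x * g)
      (comm A1 x' + b1', comm A2 y' + b2', g * imq y' - imq x' * g) =
    \<sigma> * (b1 \<bullet> x' - b1' \<bullet> x + b2 \<bullet> y' - b2' \<bullet> y + A1 \<bullet> comm x x' + A2 \<bullet> comm y y')"
proof -
  have coad: "S_coad (x, y, imq b1 * g) (A1, A2, g) =
      (comm A1 x + b1, comm A2 y + b2, g * imq y - imq x * g)"
    if "imq b2 = - (cnj_quat g * imq b1 * g)" for x y b1 b2
  proof -
    have "qim (g * cnj_quat (imq b1 * g)) = - b1" "qim (cnj_quat (imq b1 * g) * g) = qim (imq b2)"
      using g that by (simp_all add: mult.assoc del: qim_imq) (simp add: mult.assoc[symmetric])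
    then show ?thesis by (simp add: S_coad_eq)
  qed
  have 1: "g \<bullet> (imq x * (imq b * g)) = - (b \<bullet> x)" for x b
  proof -
    have "(imq x * (imq b * g)) \<bullet> g = imq x \<bullet> (g * cnj_quat g * cnj_quat (imq b))"
      unfolding inner_mult_cnj_right[of "imq x"] by (simp add: mult.assoc)
    also have "\<dots> = - (b \<bullet> x)"
      using g by (simp add: inner_commute)
    finally show ?thesis by (simp only: inner_commute)
  qed
  have 2: "g \<bullet> (imq b1 * g * imq y) = b2 \<bullet> y" if "imq b2 = - (cnj_quat g * imq b1 * g)" for y b1 b2
  proof -
    have "(imq b1 * g * imq y) \<bullet> g = imq y \<bullet> imq b2"
      unfolding inner_mult_cnj_left[of "imq b1 * g"] that by (simp add: mult.assoc)
    also have "\<dots> = b2 \<bullet> y"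
      by (simp add: inner_commute)
    finally show ?thesis by (simp only: inner_commute)
  qed
  show ?thesis
    unfolding coad[OF b2, symmetric] coad[OF b2', symmetric] kks_form_coad
    by (simp add: inner_Pair inner_diff_right 1 2[OF b2] 2[OF b2'])
qed

text \<open>For a fixed vector the 1-form is linear in the base point, hence its own
  derivative.\<close>

lemma ext_deriv_tautological:
  "ext_deriv tautological z v v' = tautological v v' - tautological v' v"
proof -
  have t: "tautological y w = fst (snd y) \<bullet> fst w + snd (snd (snd y)) \<bullet> fst (snd (snd w))" for y w
    by (cases y; cases w) simp
  have "((\<lambda>y. tautological y w) has_derivative (\<lambda>y. tautological y w)) (at z)" for w
    unfolding t by (auto intro!: derivative_eq_intros)
  from frechet_derivative_at[OF this, symmetric] show ?thesis
    by (simp only: ext_deriv_def)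
qed

lemma phase_set_iff:
  "(g1, p1, g2, p2) \<in> phase_set \<longleftrightarrow>
    g1 \<in> S3 \<and> g2 \<in> S3 \<and> qre (cnj_quat g1 * p1) = 0 \<and> qre (cnj_quat g2 * p2) = 0"
  by (simp add: phase_set_def inner_quat_qre[symmetric] inner_commute)

text \<open>Differentiates the unit norm of each \<open>g\<close> and the orthogonality of each
  \<open>p\<close> to its \<open>g\<close>.\<close>

lemma phase_curve_constraints:
  assumes "smooth_curve (embedded Z) \<gamma>" "Z \<subseteq> phase_set"
    and z: "\<gamma> 0 = (g1, p1, g2, p2)" "vector_derivative \<gamma> (at 0) = (v1, w1, v2, w2)"
  shows "g1 \<bullet> v1 = 0" "g2 \<bullet> v2 = 0" "w1 \<bullet> g1 + p1 \<bullet> v1 = 0" "w2 \<bullet> g2 + p2 \<bullet> v2 = 0"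
proof -
  have 1: "fst z \<bullet> fst z = 1" "fst (snd (snd z)) \<bullet> fst (snd (snd z)) = 1"
     "fst (snd z) \<bullet> fst z = 0" "snd (snd (snd z)) \<bullet> fst (snd (snd z)) = 0" if "z \<in> Z" for z
    using that assms(2) by (auto simp: phase_set_def norm_eq_1)
  note * = derivative_constant_along_curve[OF assms(1)]
  have "2 * (g1 \<bullet> v1) = 0"
    using *[of "\<lambda>z. fst z \<bullet> fst z" "\<lambda>w. 2 * (fst (\<gamma> 0) \<bullet> fst w)", OF _ 1(1)]
    by (force intro!: derivative_eq_intros simp: z inner_commute)
  then show "g1 \<bullet> v1 = 0" by simp
  have "2 * (g2 \<bullet> v2) = 0"
    using *[of "\<lambda>z. fst (snd (snd z)) \<bullet> fst (snd (snd z))" "\<lambda>w. 2 * (fst (snd (snd (\<gamma> 0))) \<bullet> fst (snd (snd w)))", OF _ 1(2)]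
    by (force intro!: derivative_eq_intros simp: z inner_commute)
  then show "g2 \<bullet> v2 = 0" by simp
  show "w1 \<bullet> g1 + p1 \<bullet> v1 = 0"
    using *[of "\<lambda>z. fst (snd z) \<bullet> fst z" "\<lambda>w. fst (snd w) \<bullet> fst (\<gamma> 0) + fst (snd (\<gamma> 0)) \<bullet> fst w", OF _ 1(3)]
    by (force intro!: derivative_eq_intros simp: z)
  show "w2 \<bullet> g2 + p2 \<bullet> v2 = 0"
    using *[of "\<lambda>z. snd (snd (snd z)) \<bullet> fst (snd (snd z))" "\<lambda>w. snd (snd (snd w)) \<bullet> fst (snd (snd (\<gamma> 0)))
        + snd (snd (snd (\<gamma> 0))) \<bullet> fst (snd (snd w))", OF _ 1(4)]
    by (force intro!: derivative_eq_intros simp: z)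
qed

section \<open>Reduction described by frames\<close>

lemma isotropy_coad3: "isotropy S3 coad3 \<nu> = {h \<in> S3. h * \<nu> = \<nu> * h}"
proof -
  have "h * \<nu> * cnj_quat h = \<nu> \<longleftrightarrow> h * \<nu> = \<nu> * h" if "h \<in> S3" for h
    using that by (metis S3_cnj(1,2) mult.assoc mult.right_neutral)
  then show ?thesis
    unfolding isotropy_def coad3_def by (intro Collect_cong conj_cong refl) simp
qed

text \<open>\<open>lift k \<mu>\<close> is the point over the orbit point \<open>\<mu>\<close> whose frame is \<open>k\<close>; it lies on the momentum level
  \<open>\<nu>\<close> iff \<open>k\<close> conjugates \<open>mom \<mu>\<close>, the momentum in the body frame, to \<open>\<nu>\<close>.\<close>

theorem reduction_by_lift:
  fixes \<nu> :: quat and act :: "quat \<Rightarrow> phase \<Rightarrow> phase" and \<Phi> :: "phase \<Rightarrow> salg"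
    and lift :: "quat \<Rightarrow> salg \<Rightarrow> phase" and mom :: "salg \<Rightarrow> real^3" and J :: "phase \<Rightarrow> quat"
  defines "Z \<equiv> level_set phase_space J \<nu>" and "\<O> \<equiv> casimir_level ((norm \<nu>)\<^sup>2)"
  assumes \<nu>: "qre \<nu> = 0"
    and smooth: "smooth_on UNIV \<Phi>" "smooth_on UNIV mom"
      "\<And>U r. open U \<Longrightarrow> smooth_on U r \<Longrightarrow> smooth_on U (\<lambda>\<mu>. lift (r \<mu>) \<mu>)"
    and mom: "\<And>\<mu>. \<mu> \<in> \<O> \<Longrightarrow> norm (mom \<mu>) = norm \<nu>"
    and frame: "\<And>z. z \<in> Z \<Longrightarrow> \<Phi> z \<in> \<O> \<and> (\<exists>k\<in>S3. z = lift k (\<Phi> z) \<and> k * imq (mom (\<Phi> z)) = \<nu> * k)"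
    and lift: "\<And>k \<mu>. k \<in> S3 \<Longrightarrow> \<mu> \<in> \<O> \<Longrightarrow> k * imq (mom \<mu>) = \<nu> * k \<Longrightarrow> lift k \<mu> \<in> Z \<and> \<Phi> (lift k \<mu>) = \<mu>"
    and act: "\<And>h k \<mu>. h \<in> S3 \<Longrightarrow> k \<in> S3 \<Longrightarrow> act h (lift k \<mu>) = lift (h * k) \<mu>"
    and form: "\<And>\<gamma> \<delta>. smooth_curve (embedded Z) \<gamma> \<Longrightarrow> smooth_curve (embedded Z) \<delta> \<Longrightarrow> \<gamma> 0 = \<delta> 0 \<Longrightarrow>
      ext_deriv tautological (\<gamma> 0) (vector_derivative \<gamma> (at 0)) (vector_derivative \<delta> (at 0)) =
      kks_form \<sigma> (\<Phi> (\<gamma> 0)) (vector_derivative (\<Phi> \<circ> \<gamma>) (at 0)) (vector_derivative (\<Phi> \<circ> \<delta>) (at 0))"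
  shows "\<exists>\<phi>. symplectomorphism (reduced_space phase_space S3 act coad3 J \<nu>) (orbit_space \<sigma> \<O>) \<phi> \<and>
    (\<forall>z\<in>Z. \<phi> (action_orbit (isotropy S3 coad3 \<nu>) act z) = \<Phi> z)"
  unfolding Z_def orbit_space_def phase_space_def
proof (rule reduced_space_symplectomorphism)
  note Z = Z_def[unfolded phase_space_def, symmetric]
  \<comment> \<open>The frames that put a point over \<mu> on the momentum level.\<close>
  define F where "F \<mu> = {k \<in> S3. k * imq (mom \<mu>) = \<nu> * k}" for \<mu>
  \<comment> \<open>Each reduced orbit consists of the lifts of all frames over its image, so it is
    determined by \<open>\<Phi> z\<close>.\<close>
  have orbit: "action_orbit (isotropy S3 coad3 \<nu>) act z = (\<lambda>j. lift j (\<Phi> z)) ` F (\<Phi> z)" if "z \<in> Z" for z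
  proof -
    from frame[OF that] obtain k where k: "k \<in> S3" "z = lift k (\<Phi> z)" "k * imq (mom (\<Phi> z)) = \<nu> * k"
      by blast
    \<comment> \<open>Two frames over the same point differ by a left factor commuting with \<nu>,
      so the frames form one coset of the isotropy group.\<close>
    have F: "(\<lambda>h. h * k) ` isotropy S3 coad3 \<nu> = F (\<Phi> z)"
    proof (intro equalityI subsetI)
      fix j assume "j \<in> (\<lambda>h. h * k) ` isotropy S3 coad3 \<nu>"
      then obtain h where "j = h * k" "h \<in> S3" "h * \<nu> = \<nu> * h" by (auto simp: isotropy_coad3)
      then show "j \<in> F (\<Phi> z)"
        using k S3_closed(1) by (simp only: F_def mem_Collect_eq mult.assoc) (metis mult.assoc)
    next
      fix j assume "j \<in> F (\<Phi> z)"
      then have j: "j \<in> S3" "j * imq (mom (\<Phi> z)) = \<nu> * j" by (auto simp: F_def)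
      have "cnj_quat k * \<nu> = imq (mom (\<Phi> z)) * cnj_quat k"
        using k(3) S3_cnj(1,2,4)[OF k(1)] by (metis mult.assoc mult.right_neutral)
      then have "(j * cnj_quat k) * \<nu> = \<nu> * (j * cnj_quat k)"
        using j(2) by (metis mult.assoc)
      moreover have "j * cnj_quat k \<in> S3" by (intro S3_closed j k)
      moreover have "j = (j * cnj_quat k) * k" using k(1) by (simp add: mult.assoc)
      ultimately show "j \<in> (\<lambda>h. h * k) ` isotropy S3 coad3 \<nu>"
        unfolding isotropy_coad3 by blast
    qed
    have "act h z = lift (h * k) (\<Phi> z)" if "h \<in> isotropy S3 coad3 \<nu>" for h
      using act[of h k "\<Phi> z"] k(1,2) that by (simp add: isotropy_coad3)
    then have "action_orbit (isotropy S3 coad3 \<nu>) act z =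
        (\<lambda>j. lift j (\<Phi> z)) ` (\<lambda>h. h * k) ` isotropy S3 coad3 \<nu>"
      unfolding action_orbit_def image_image by (rule image_cong[OF refl])
    then show ?thesis by (simp only: F)
  qed
  have mem: "z \<in> (\<lambda>j. lift j (\<Phi> z)) ` F (\<Phi> z)" if "z \<in> Z" for z
    using frame[OF that] by (auto simp: F_def)
  show "smooth_on UNIV \<Phi>" by fact
  show "\<Phi> ` level_set (embedded_symp phase_set (ext_deriv tautological)) J \<nu> = \<O>"
    unfolding Z
  proof (intro equalityI subsetI)
    fix \<mu> assume \<mu>: "\<mu> \<in> \<O>"
    have "norm (mom \<mu>) = norm (qim \<nu>)"
      using mom[OF \<mu>] imq_qim[OF \<nu>] by (metis norm_imq)
    from S3_rotation[OF this] obtain k where "k \<in> S3" "k * imq (mom \<mu>) = \<nu> * k"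
      unfolding imq_qim[OF \<nu>] by blast
    from lift[OF this(1) \<mu> this(2)] show "\<mu> \<in> \<Phi> ` Z" by (metis imageI)
  qed (use frame in blast)
  show "action_orbit (isotropy S3 coad3 \<nu>) act z = action_orbit (isotropy S3 coad3 \<nu>) act z' \<longleftrightarrow> \<Phi> z = \<Phi> z'"
    if "z \<in> level_set (embedded_symp phase_set (ext_deriv tautological)) J \<nu>"
      "z' \<in> level_set (embedded_symp phase_set (ext_deriv tautological)) J \<nu>" for z z'
    using that unfolding Z
  proof -
    assume z: "z \<in> Z" "z' \<in> Z"
    show ?thesis
    proof
      assume "action_orbit (isotropy S3 coad3 \<nu>) act z = action_orbit (isotropy S3 coad3 \<nu>) act z'"
      \<comment> \<open>A point lies in its own orbit, hence \<open>z\<close> is a lift over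
        \<open>\<Phi> z'\<close>.\<close>
      with mem[OF z(1)] obtain j where "z = lift j (\<Phi> z')" "j \<in> F (\<Phi> z')"
        unfolding orbit[OF z(1)] orbit[OF z(2)] by blast
      then show "\<Phi> z = \<Phi> z'"
        using lift[of j "\<Phi> z'"] frame[OF z(2)] by (auto simp: F_def)
    qed (simp only: orbit z)
  qed
  show "\<exists>U s. open U \<and> \<Phi> z \<in> U \<and> smooth_on U s \<and> s (\<Phi> z) = z \<and>
      (\<forall>y\<in>U \<inter> \<O>. s y \<in> level_set (embedded_symp phase_set (ext_deriv tautological)) J \<nu> \<and> \<Phi> (s y) = y)"
    if "z \<in> level_set (embedded_symp phase_set (ext_deriv tautological)) J \<nu>" for z
  proof -
    from that have "z \<in> Z" unfolding Z .
    from frame[OF this] obtain k where k: "k \<in> S3" "z = lift k (\<Phi> z)" "k * imq (mom (\<Phi> z)) = \<nu> * k"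
      by blast
    \<comment> \<open>The frame becomes a smooth function of the body momentum with value
      \<open>k\<close> at \<open>\<Phi> z\<close>, so the resulting section passes through
      \<open>z\<close>.\<close>
    from smooth_local_rotation[OF \<nu> k(1,3)] obtain V r where r: "open V" "imq (mom (\<Phi> z)) \<in> V"
      "smooth_on V r" "r (imq (mom (\<Phi> z))) = k"
      "\<And>n. n \<in> V \<Longrightarrow> qre n = 0 \<Longrightarrow> norm n = norm \<nu> \<Longrightarrow> r n \<in> S3 \<and> r n * n = \<nu> * r n" by blast
    define U where "U = (\<lambda>\<mu>. imq (mom \<mu>)) -` V"
    have m: "smooth_on UNIV (\<lambda>\<mu>. imq (mom \<mu>))"
      by (intro smooth_on_imq smooth open_UNIV)
    then have U: "open U"
      unfolding U_def by (intro open_vimage r(1) smooth_on_imp_continuous_on)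
    have "smooth_on U (\<lambda>\<mu>. r (imq (mom \<mu>)))"
      by (rule smooth_on_compose[OF U r(1) _ smooth_on_subset[OF m] r(3)]) (auto simp: U_def)
    then have "smooth_on U (\<lambda>\<mu>. lift (r (imq (mom \<mu>))) \<mu>)"
      by (rule smooth(3)[OF U])
    moreover have "lift (r (imq (mom \<mu>))) \<mu> \<in> Z \<and> \<Phi> (lift (r (imq (mom \<mu>))) \<mu>) = \<mu>"
      if "\<mu> \<in> U \<inter> \<O>" for \<mu>
      using that r(5)[of "imq (mom \<mu>)"] mom[of \<mu>] lift by (simp add: U_def)
    ultimately show ?thesis
      unfolding Z using U r(2,4) k(2)
      by (intro exI[of _ U] exI[of _ "\<lambda>\<mu>. lift (r (imq (mom \<mu>))) \<mu>"]) (auto simp: U_def)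
  qed
qed (rule form[unfolded Z_def phase_space_def])

section \<open>Invariant maps and lifts for the two actions\<close>

lemma level_set_phase_space: "level_set phase_space J \<nu> = {z \<in> phase_set. J z = \<nu>}"
  by (simp add: level_set_def phase_space_def)

lemma norm_rot: "g \<in> S3 \<Longrightarrow> norm (rot g x) = norm x"
  unfolding norm_imq[symmetric] imq_rot by (simp add: norm_mult)

text \<open>On phase space these are \<open>(R1, R2, gL)\<close>. Conjugates replace inverses, with
  which they agree on unit quaternions, so that the map is polynomial on the whole ambient
  space.\<close>

definition left_map :: "phase \<Rightarrow> salg" where
  "left_map z = (qim (cnj_quat (fst z) * fst (snd z)),
     qim (cnj_quat (fst (snd (snd z))) * snd (snd (snd z))), cnj_quat (fst z) * fst (snd (snd z)))"

text \<open>The frame is \<open>g1\<close>, so that \<open>g2 = g1 * gL\<close> and the momenta are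
  \<open>g1 * R1\<close> and \<open>g2 * R2\<close>.\<close>

definition left_lift :: "quat \<Rightarrow> salg \<Rightarrow> phase" where
  "left_lift k \<mu> = (k, k * imq (fst \<mu>), k * snd (snd \<mu>), k * snd (snd \<mu>) * imq (fst (snd \<mu>)))"

text \<open>The momentum seen in the frame \<open>g1\<close>, that is,
  \<open>cnj_quat g1 * JL * g1\<close>.\<close>

definition left_mom :: "salg \<Rightarrow> real^3" where
  "left_mom \<mu> = fst \<mu> + rot (snd (snd \<mu>)) (fst (snd \<mu>))"

definition right_map :: "phase \<Rightarrow> salg" where
  "right_map z = (qim (fst (snd z) * cnj_quat (fst z)),
     qim (snd (snd (snd z)) * cnj_quat (fst (snd (snd z)))), fst z * cnj_quat (fst (snd (snd z))))"

text \<open>The frame is the conjugate of \<open>g2\<close>, so that the right action becomes left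
  multiplication of the frame, as in the left case.\<close>

definition right_lift :: "quat \<Rightarrow> salg \<Rightarrow> phase" where
  "right_lift k \<mu> = (snd (snd \<mu>) * cnj_quat k, imq (fst \<mu>) * snd (snd \<mu>) * cnj_quat k,
     cnj_quat k, imq (fst (snd \<mu>)) * cnj_quat k)"

text \<open>The momentum seen in this frame, that is, \<open>g2 * JR * cnj_quat g2\<close>.\<close>

definition right_mom :: "salg \<Rightarrow> real^3" where
  "right_mom \<mu> = rot (cnj_quat (snd (snd \<mu>))) (fst \<mu>) + fst (snd \<mu>)"

section \<open>Trivialized velocities of a single particle\<close>

lemma inner_S3_left: "g \<in> S3 \<Longrightarrow> (g * p) \<bullet> (g * q) = p \<bullet> q"
  by (simp add: inner_mult_cnj_left[of g])

lemma inner_S3_right: "g \<in> S3 \<Longrightarrow> (p * g) \<bullet> (q * g) = p \<bullet> q"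
  by (simp add: inner_mult_cnj_right[of p] mult.assoc)

lemma qre_mult_imaginary: "qre p = 0 \<Longrightarrow> qre (p * q) = - (p \<bullet> q)"
proof -
  assume "qre p = 0"
  then have "cnj_quat p = - p" by (simp add: quat_eq_iff)
  then show ?thesis by (simp add: inner_quat_qre)
qed

text \<open>With \<open>A = cnj_quat g * p\<close>, the vector \<open>b\<close> measures how far the
  velocity of \<open>A\<close> departs from \<open>comm A x\<close>. The differentiated constraints
  make \<open>x\<close> and \<open>b\<close> imaginary.\<close>

lemma left_particle:
  assumes g: "g \<in> S3" and "qre (cnj_quat g * p) = 0" "g \<bullet> v = 0" "w \<bullet> g + p \<bullet> v = 0"
  shows "\<exists>x b. v = g * imq x \<and> w = g * (imq b + imq (qim (cnj_quat g * p)) * imq x)"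
proof -
  have A: "imq (qim (cnj_quat g * p)) = cnj_quat g * p" by (rule imq_qim) fact
  have x: "imq (qim (cnj_quat g * v)) = cnj_quat g * v"
    by (rule imq_qim) (use assms(3) in \<open>simp add: inner_quat_qre\<close>)
  let ?B = "cnj_quat g * w - cnj_quat g * p * (cnj_quat g * v)"
  have "qre (cnj_quat g * p * (cnj_quat g * v)) = - ((cnj_quat g * p) \<bullet> (cnj_quat g * v))"
    by (rule qre_mult_imaginary) fact
  also have "\<dots> = - (p \<bullet> v)" using inner_S3_left[OF S3_closed(2)[OF g]] by simp
  finally have "qre ?B = 0"
    using assms(4) by (simp add: inner_quat_qre[symmetric] inner_commute)
  from imq_qim[OF this] show ?thesis
    by (intro exI[of _ "qim (cnj_quat g * v)"] exI[of _ "qim ?B"]) (use A x g in simp)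
qed

text \<open>The sign of \<open>x\<close> is chosen so that the velocity of
  \<open>A = p * cnj_quat g\<close> is again \<open>comm A x + b\<close>, as on the left.\<close>

lemma right_particle:
  assumes g: "g \<in> S3" and "qre (p * cnj_quat g) = 0" "g \<bullet> v = 0" "w \<bullet> g + p \<bullet> v = 0"
  shows "\<exists>x b. v = - (imq x * g) \<and> w = (imq b - imq x * imq (qim (p * cnj_quat g))) * g"
proof -
  have A: "imq (qim (p * cnj_quat g)) = p * cnj_quat g" by (rule imq_qim) fact
  have xi: "qre (v * cnj_quat g) = 0"
    using assms(3) by (subst qre_mult_commute) (simp add: inner_quat_qre)
  then have x: "imq (qim (- (v * cnj_quat g))) = - (v * cnj_quat g)"
    by (intro imq_qim) simp
  let ?B = "w * cnj_quat g - v * cnj_quat g * (p * cnj_quat g)"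
  have "qre (v * cnj_quat g * (p * cnj_quat g)) = - ((v * cnj_quat g) \<bullet> (p * cnj_quat g))"
    by (rule qre_mult_imaginary[OF xi])
  also have "\<dots> = - (p \<bullet> v)"
    using inner_S3_right[OF S3_closed(2)[OF g]] by (simp add: inner_commute)
  finally have "qre ?B = 0"
    using assms(4) by (simp add: qre_mult_commute[of w] inner_quat_qre[symmetric] inner_commute)
  from imq_qim[OF this] show ?thesis
    by (intro exI[of _ "qim (- (v * cnj_quat g))"] exI[of _ "qim ?B"])
      (use A x g in \<open>simp add: mult.assoc left_diff_distrib distrib_right\<close>)
qed

text \<open>The summand of the canonical form that belongs to one particle; its products with
  \<open>A\<close> combine to a commutator when moved across the inner product.\<close>

lemma left_particle_form:
  assumes "g \<in> S3"
  shows "(g * (imq b + imq A * imq x)) \<bullet> (g * imq x') - (g * (imq b' + imq A * imq x')) \<bullet> (g * imq x) =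
    b \<bullet> x' - b' \<bullet> x + A \<bullet> comm x x'"
  unfolding inner_S3_left[OF assms] inner_imq[of A, symmetric] imq_comm
  by (simp add: inner_add_left inner_diff_right inner_mult_cnj_right[of "imq A"])

text \<open>The minus sign in the velocities turns the left expression into its negative, the origin
  of the sign \<open>-1\<close> on the right.\<close>

lemma right_particle_form:
  assumes "g \<in> S3"
  shows "((imq b - imq x * imq A) * g) \<bullet> (- (imq x' * g)) - ((imq b' - imq x' * imq A) * g) \<bullet> (- (imq x * g)) =
    - (b \<bullet> x' - b' \<bullet> x + A \<bullet> comm x x')"
  unfolding inner_minus_right inner_S3_right[OF assms] inner_imq[of A, symmetric] imq_comm
  by (simp add: inner_diff_left inner_diff_right inner_mult_cnj_left[of "imq x"]
      inner_mult_cnj_left[of "imq x'"])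

section \<open>Tangent vectors of the momentum levels\<close>

lemmas has_derivative_cnj = bounded_linear.has_derivative[OF bounded_linear_cnj]
lemmas has_derivative_qim = bounded_linear.has_derivative[OF bounded_linear_qim]

text \<open>Constancy of \<open>JL\<close> along the curve links \<open>b1\<close> and
  \<open>b2\<close> by exactly the relation that \<open>kks_form_orbit\<close> requires.\<close>

lemma left_curve:
  assumes \<gamma>: "smooth_curve (embedded (level_set phase_space JL \<nu>)) \<gamma>"
    and z: "\<gamma> 0 = (g1, p1, g2, p2)" "left_map (\<gamma> 0) = (A1, A2, g)"
  shows "\<exists>x y b1 b2. vector_derivative \<gamma> (at 0) = (g1 * imq x, g1 * (imq b1 + imq A1 * imq x),
        g2 * imq y, g2 * (imq b2 + imq A2 * imq y)) \<and>
      imq b2 = - (cnj_quat g * imq b1 * g) \<and>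
      vector_derivative (left_map \<circ> \<gamma>) (at 0) =
        (comm A1 x + b1, comm A2 y + b2, g * imq y - imq x * g)"
proof -
  let ?Z = "level_set phase_space JL \<nu>"
  obtain v1 w1 v2 w2 where v: "vector_derivative \<gamma> (at 0) = (v1, w1, v2, w2)"
    using prod_cases4 by blast
  have sub: "?Z \<subseteq> phase_set" by (auto simp: level_set_phase_space)
  have "\<gamma> 0 \<in> ?Z" using eventually_nhds_x_imp_x[OF eventually_smooth_curve[OF \<gamma>]] by simp
  then have z': "g1 \<in> S3" "g2 \<in> S3" "qre (cnj_quat g1 * p1) = 0" "qre (cnj_quat g2 * p2) = 0"
    using sub z(1) by (auto simp only: phase_set_iff)
  have A: "A1 = qim (cnj_quat g1 * p1)" "A2 = qim (cnj_quat g2 * p2)" and g: "g = cnj_quat g1 * g2"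
    using z by (auto simp: left_map_def)
  note c = phase_curve_constraints[OF \<gamma> sub z(1) v]
  from left_particle[OF z'(1,3) c(1,3)] obtain x b1 where
    v1: "v1 = g1 * imq x" "w1 = g1 * (imq b1 + imq A1 * imq x)" unfolding A by blast
  from left_particle[OF z'(2,4) c(2,4)] obtain y b2 where
    v2: "v2 = g2 * imq y" "w2 = g2 * (imq b2 + imq A2 * imq y)" unfolding A by blast
  have p: "p1 = g1 * imq A1" "p2 = g2 * imq A2"
    using z' by (simp_all add: A imq_qim)
  \<comment> \<open>\<open>JL\<close> with conjugates for inverses, which the product rule
    differentiates at once.\<close>
  define F where "F z = fst (snd z) * cnj_quat (fst z) +
      snd (snd (snd z)) * cnj_quat (fst (snd (snd z)))" for z :: phase
  define F' where "F' w = fst (snd (\<gamma> 0)) * cnj_quat (fst w) + fst (snd w) * cnj_quat (fst (\<gamma> 0)) +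
      (snd (snd (snd (\<gamma> 0))) * cnj_quat (fst (snd (snd w))) +
       snd (snd (snd w)) * cnj_quat (fst (snd (snd (\<gamma> 0)))))" for w :: phase
  have "(F has_derivative F') (at (\<gamma> 0))"
    unfolding F_def[abs_def] F'_def[abs_def]
    by (auto intro!: derivative_eq_intros has_derivative_cnj)
  moreover have "F z = \<nu>" if "z \<in> ?Z" for z
    using that by (cases z) (auto simp: level_set_phase_space phase_set_def F_def JL_def)
  ultimately have "F' (vector_derivative \<gamma> (at 0)) = 0"
    by (rule derivative_constant_along_curve[OF \<gamma>])
  \<comment> \<open>In the derivative of \<open>p * cnj_quat g\<close> the terms with
    \<open>A\<close> cancel, leaving \<open>g * imq b * cnj_quat g\<close> for each
    particle.\<close>
  then have "g1 * imq b1 * cnj_quat g1 + g2 * imq b2 * cnj_quat g2 = 0"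
    by (simp add: F'_def z(1) v v1 v2 p algebra_simps)
  then have "g2 * imq b2 * cnj_quat g2 = - (g1 * imq b1 * cnj_quat g1)"
    by (simp add: eq_neg_iff_add_eq_0 add.commute)
  then have "cnj_quat g2 * (g2 * imq b2 * cnj_quat g2) * g2 = - (cnj_quat g2 * (g1 * imq b1 * cnj_quat g1) * g2)"
    by simp
  then have b2: "imq b2 = - (cnj_quat g * imq b1 * g)"
    using z' by (simp add: g mult.assoc)
  let ?D = "\<lambda>w. (qim (cnj_quat (fst (\<gamma> 0)) * fst (snd w) + cnj_quat (fst w) * fst (snd (\<gamma> 0))),
     qim (cnj_quat (fst (snd (snd (\<gamma> 0)))) * snd (snd (snd w)) +
       cnj_quat (fst (snd (snd w))) * snd (snd (snd (\<gamma> 0)))),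
     cnj_quat (fst (\<gamma> 0)) * fst (snd (snd w)) + cnj_quat (fst w) * fst (snd (snd (\<gamma> 0))))"
  have "(left_map has_derivative ?D) (at (\<gamma> 0))"
    unfolding left_map_def[abs_def]
    by (auto intro!: derivative_eq_intros has_derivative_cnj has_derivative_qim)
  from vector_derivative_compose_curve[OF \<gamma> this]
  have "vector_derivative (left_map \<circ> \<gamma>) (at 0) =
      (comm A1 x + b1, comm A2 y + b2, g * imq y - imq x * g)"
    using z' by (simp add: z(1) v v1 v2 p g comm_def mult.assoc distrib_left)
  with v1 v2 v b2 show ?thesis by blast
qed

text \<open>Mirror image of \<open>left_curve\<close>: \<open>JR\<close> is constant and the
  derivative of \<open>cnj_quat g * p\<close> reduces to \<open>cnj_quat g * imq b * g\<close>. The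
  sign convention of \<open>right_particle\<close> keeps the formula for the projected velocity
  unchanged.\<close>

lemma right_curve:
  assumes \<gamma>: "smooth_curve (embedded (level_set phase_space JR \<nu>)) \<gamma>"
    and z: "\<gamma> 0 = (g1, p1, g2, p2)" "right_map (\<gamma> 0) = (A1, A2, g)"
  shows "\<exists>x y b1 b2. vector_derivative \<gamma> (at 0) = (- (imq x * g1), (imq b1 - imq x * imq A1) * g1,
        - (imq y * g2), (imq b2 - imq y * imq A2) * g2) \<and>
      imq b2 = - (cnj_quat g * imq b1 * g) \<and>
      vector_derivative (right_map \<circ> \<gamma>) (at 0) =
        (comm A1 x + b1, comm A2 y + b2, g * imq y - imq x * g)"
proof -
  let ?Z = "level_set phase_space JR \<nu>"
  obtain v1 w1 v2 w2 where v: "vector_derivative \<gamma> (at 0) = (v1, w1, v2, w2)"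
    using prod_cases4 by blast
  have sub: "?Z \<subseteq> phase_set" by (auto simp: level_set_phase_space)
  have "\<gamma> 0 \<in> ?Z" using eventually_nhds_x_imp_x[OF eventually_smooth_curve[OF \<gamma>]] by simp
  then have z': "g1 \<in> S3" "g2 \<in> S3" "qre (p1 * cnj_quat g1) = 0" "qre (p2 * cnj_quat g2) = 0"
    using sub z(1) unfolding qre_mult_commute[of p1] qre_mult_commute[of p2]
    by (auto simp only: phase_set_iff)
  have A: "A1 = qim (p1 * cnj_quat g1)" "A2 = qim (p2 * cnj_quat g2)" and g: "g = g1 * cnj_quat g2"
    using z by (auto simp: right_map_def)
  note c = phase_curve_constraints[OF \<gamma> sub z(1) v]
  from right_particle[OF z'(1,3) c(1,3)] obtain x b1 where
    v1: "v1 = - (imq x * g1)" "w1 = (imq b1 - imq x * imq A1) * g1" unfolding A by blast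
  from right_particle[OF z'(2,4) c(2,4)] obtain y b2 where
    v2: "v2 = - (imq y * g2)" "w2 = (imq b2 - imq y * imq A2) * g2" unfolding A by blast
  have p: "p1 = imq A1 * g1" "p2 = imq A2 * g2"
    using z' by (simp_all add: A imq_qim mult.assoc)
  define F where "F z = cnj_quat (fst z) * fst (snd z) +
      cnj_quat (fst (snd (snd z))) * snd (snd (snd z))" for z :: phase
  define F' where "F' w = cnj_quat (fst (\<gamma> 0)) * fst (snd w) + cnj_quat (fst w) * fst (snd (\<gamma> 0)) +
      (cnj_quat (fst (snd (snd (\<gamma> 0)))) * snd (snd (snd w)) +
       cnj_quat (fst (snd (snd w))) * snd (snd (snd (\<gamma> 0))))" for w :: phase
  have "(F has_derivative F') (at (\<gamma> 0))"
    unfolding F_def[abs_def] F'_def[abs_def]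
    by (auto intro!: derivative_eq_intros has_derivative_cnj)
  moreover have "F z = \<nu>" if "z \<in> ?Z" for z
    using that by (cases z) (auto simp: level_set_phase_space phase_set_def F_def JR_def)
  ultimately have "F' (vector_derivative \<gamma> (at 0)) = 0"
    by (rule derivative_constant_along_curve[OF \<gamma>])
  then have "cnj_quat g1 * imq b1 * g1 + cnj_quat g2 * imq b2 * g2 = 0"
    by (simp add: F'_def z(1) v v1 v2 p algebra_simps)
  then have "cnj_quat g2 * imq b2 * g2 = - (cnj_quat g1 * imq b1 * g1)"
    by (simp add: eq_neg_iff_add_eq_0 add.commute)
  then have "g2 * (cnj_quat g2 * imq b2 * g2) * cnj_quat g2 = - (g2 * (cnj_quat g1 * imq b1 * g1) * cnj_quat g2)"
    by simp
  then have b2: "imq b2 = - (cnj_quat g * imq b1 * g)"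
    using z' by (simp add: g mult.assoc)
  let ?D = "\<lambda>w. (qim (fst (snd (\<gamma> 0)) * cnj_quat (fst w) + fst (snd w) * cnj_quat (fst (\<gamma> 0))),
     qim (snd (snd (snd (\<gamma> 0))) * cnj_quat (fst (snd (snd w))) +
       snd (snd (snd w)) * cnj_quat (fst (snd (snd (\<gamma> 0))))),
     fst (\<gamma> 0) * cnj_quat (fst (snd (snd w))) + fst w * cnj_quat (fst (snd (snd (\<gamma> 0)))))"
  have "(right_map has_derivative ?D) (at (\<gamma> 0))"
    unfolding right_map_def[abs_def]
    by (auto intro!: derivative_eq_intros has_derivative_cnj has_derivative_qim)
  from vector_derivative_compose_curve[OF \<gamma> this]
  have "vector_derivative (right_map \<circ> \<gamma>) (at 0) =
      (comm A1 x + b1, comm A2 y + b2, g * imq y - imq x * g)"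
    using z' by (simp add: z(1) v v1 v2 p g comm_def mult.assoc left_diff_distrib)
  with v1 v2 v b2 show ?thesis by blast
qed

section \<open>The left and right reduced spaces\<close>

lemma left_reduction:
  assumes \<nu>: "qre \<nu> = 0"
  shows "\<exists>\<phi>. symplectomorphism (left_reduced \<nu>) (orbit_space 1 (casimir_level ((norm \<nu>)\<^sup>2))) \<phi> \<and>
    (\<forall>z\<in>level_set phase_space JL \<nu>. \<phi> (left_proj \<nu> z) = left_map z)"
  unfolding left_reduced_def left_proj_def
proof (rule reduction_by_lift[where lift = left_lift and mom = left_mom])
  show "smooth_on UNIV left_map" "smooth_on UNIV left_mom"
    unfolding left_map_def[abs_def] left_mom_def[abs_def]
    by (intro smooth_on_quat_intros smooth_on_rot)+
  show "smooth_on U (\<lambda>\<mu>. left_lift (r \<mu>) \<mu>)" if "open U" "smooth_on U r" for U r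
    unfolding left_lift_def by (intro smooth_on_quat_intros that)
  show mom: "norm (left_mom \<mu>) = norm \<nu>" if "\<mu> \<in> casimir_level ((norm \<nu>)\<^sup>2)" for \<mu>
    using that by (cases \<mu>) (simp add: casimir_level_iff left_mom_def)
  show "left_map z \<in> casimir_level ((norm \<nu>)\<^sup>2) \<and>
      (\<exists>k\<in>S3. z = left_lift k (left_map z) \<and> k * imq (left_mom (left_map z)) = \<nu> * k)"
    if "z \<in> level_set phase_space JL \<nu>" for z
  proof -
    obtain g1 p1 g2 p2 where z: "z = (g1, p1, g2, p2)" by (cases z)
    with that have z': "g1 \<in> S3" "g2 \<in> S3" "qre (cnj_quat g1 * p1) = 0" "qre (cnj_quat g2 * p2) = 0"
      and J: "p1 * cnj_quat g1 + p2 * cnj_quat g2 = \<nu>"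
      by (auto simp: level_set_phase_space phase_set_iff JL_def simp del: mem_sphere_0)
    \<comment> \<open>Yields both the Casimir value, since conjugation by a unit preserves the norm,
      and the frame condition for \<open>g1\<close>.\<close>
    have mom: "imq (left_mom (left_map z)) = cnj_quat g1 * \<nu> * g1"
      using z' by (simp add: z left_mom_def left_map_def imq_rot imq_qim J[symmetric] mult.assoc
          distrib_left distrib_right)
    have "norm (left_mom (left_map z)) = norm \<nu>"
      unfolding norm_imq[symmetric] mom using z' by (simp add: norm_mult)
    moreover have "cnj_quat g1 * g2 \<in> S3" by (intro S3_closed z')
    ultimately have "left_map z \<in> casimir_level ((norm \<nu>)\<^sup>2)"
      by (simp add: z left_map_def left_mom_def casimir_level_iff)
    moreover have "z = left_lift g1 (left_map z)"
      using z' by (simp add: z left_map_def left_lift_def imq_qim mult.assoc)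
    moreover have "g1 * imq (left_mom (left_map z)) = \<nu> * g1"
      unfolding mom using z' by (simp add: mult.assoc)
    ultimately show ?thesis using z'(1) by blast
  qed
  show "left_lift k \<mu> \<in> level_set phase_space JL \<nu> \<and> left_map (left_lift k \<mu>) = \<mu>"
    if k: "k \<in> S3" and \<mu>: "\<mu> \<in> casimir_level ((norm \<nu>)\<^sup>2)" and eq: "k * imq (left_mom \<mu>) = \<nu> * k" for k \<mu>
  proof -
    obtain A1 A2 g where [simp]: "\<mu> = (A1, A2, g)" by (cases \<mu>)
    have g: "g \<in> S3" using \<mu> by (simp add: casimir_level_iff)
    have kg: "k * g \<in> S3" by (intro S3_closed k g)
    have inv: "inverse (k * g) = cnj_quat g * cnj_quat k" using S3_cnj(3)[OF kg] by simp
    \<comment> \<open>The frame carries the body momentum back to space, and the frame condition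
      turns it into \<nu>.\<close>
    have "JL (left_lift k \<mu>) = k * imq (left_mom \<mu>) * cnj_quat k"
      using k by (simp add: JL_def left_lift_def left_mom_def inv imq_rot mult.assoc distrib_left distrib_right)
    then have "JL (left_lift k \<mu>) = \<nu>" unfolding eq using k by (simp add: mult.assoc)
    moreover have "left_lift k \<mu> \<in> phase_set"
      using k kg g by (simp add: left_lift_def phase_set_iff mult.assoc del: mem_sphere_0)
    moreover have "left_map (left_lift k \<mu>) = \<mu>"
      using k g by (simp add: left_lift_def left_map_def mult.assoc)
    ultimately show ?thesis by (simp add: level_set_phase_space)
  qed
  show "left_act h (left_lift k \<mu>) = left_lift (h * k) \<mu>" for h k \<mu>
    by (simp add: left_lift_def mult.assoc)
  fix \<gamma> \<delta> assume \<gamma>: "smooth_curve (embedded (level_set phase_space JL \<nu>)) \<gamma>"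
    and \<delta>: "smooth_curve (embedded (level_set phase_space JL \<nu>)) \<delta>" and eq: "\<gamma> 0 = \<delta> 0"
  obtain g1 p1 g2 p2 where z: "\<gamma> 0 = (g1, p1, g2, p2)" by (cases "\<gamma> 0")
  obtain A1 A2 g where \<mu>: "left_map (\<gamma> 0) = (A1, A2, g)" by (cases "left_map (\<gamma> 0)")
  have "\<gamma> 0 \<in> level_set phase_space JL \<nu>"
    using eventually_nhds_x_imp_x[OF eventually_smooth_curve[OF \<gamma>]] by simp
  then have g12: "g1 \<in> S3" "g2 \<in> S3"
    using z by (auto simp: level_set_phase_space phase_set_iff)
  have g: "g \<in> S3" using \<mu> z S3_closed g12 by (auto simp: left_map_def norm_mult)
  from left_curve[OF \<gamma> z \<mu>] obtain x y b1 b2 where 1: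
    "vector_derivative \<gamma> (at 0) = (g1 * imq x, g1 * (imq b1 + imq A1 * imq x),
        g2 * imq y, g2 * (imq b2 + imq A2 * imq y))"
    "imq b2 = - (cnj_quat g * imq b1 * g)"
    "vector_derivative (left_map \<circ> \<gamma>) (at 0) =
        (comm A1 x + b1, comm A2 y + b2, g * imq y - imq x * g)" by blast
  from left_curve[OF \<delta> z[unfolded eq] \<mu>[unfolded eq]] obtain x' y' b1' b2' where 2:
    "vector_derivative \<delta> (at 0) = (g1 * imq x', g1 * (imq b1' + imq A1 * imq x'),
        g2 * imq y', g2 * (imq b2' + imq A2 * imq y'))"
    "imq b2' = - (cnj_quat g * imq b1' * g)"
    "vector_derivative (left_map \<circ> \<delta>) (at 0) =
        (comm A1 x' + b1', comm A2 y' + b2', g * imq y' - imq x' * g)" by blast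
  \<comment> \<open>The canonical form is the sum of the two particle terms, which is the expression
    given by \<open>kks_form_orbit\<close>.\<close>
  show "ext_deriv tautological (\<gamma> 0) (vector_derivative \<gamma> (at 0)) (vector_derivative \<delta> (at 0)) =
      kks_form 1 (left_map (\<gamma> 0)) (vector_derivative (left_map \<circ> \<gamma>) (at 0)) (vector_derivative (left_map \<circ> \<delta>) (at 0))"
    unfolding \<mu> 1(3) 2(3) kks_form_orbit[OF g 1(2) 2(2)] ext_deriv_tautological 1(1) 2(1)
    using left_particle_form[OF g12(1), of b1 A1 x x' b1'] left_particle_form[OF g12(2), of b2 A2 y y' b2']
    by simp
qed (rule \<nu>)

lemma right_reduction:
  assumes \<nu>: "qre \<nu> = 0"
  shows "\<exists>\<phi>. symplectomorphism (right_reduced \<nu>) (orbit_space (-1) (casimir_level ((norm \<nu>)\<^sup>2))) \<phi> \<and>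
    (\<forall>z\<in>level_set phase_space JR \<nu>. \<phi> (right_proj \<nu> z) = right_map z)"
  unfolding right_reduced_def right_proj_def
proof (rule reduction_by_lift[where lift = right_lift and mom = right_mom])
  show "smooth_on UNIV right_map" "smooth_on UNIV right_mom"
    unfolding right_map_def[abs_def] right_mom_def[abs_def]
    by (intro smooth_on_quat_intros smooth_on_rot)+
  show "smooth_on U (\<lambda>\<mu>. right_lift (r \<mu>) \<mu>)" if "open U" "smooth_on U r" for U r
    unfolding right_lift_def by (intro smooth_on_quat_intros that)
  show mom: "norm (right_mom \<mu>) = norm \<nu>" if "\<mu> \<in> casimir_level ((norm \<nu>)\<^sup>2)" for \<mu>
  proof -
    obtain A1 A2 g where \<mu>: "\<mu> = (A1, A2, g)" by (cases \<mu>)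
    with that have g: "g \<in> S3" "norm (A1 + rot g A2) = norm \<nu>" by (simp_all add: casimir_level_iff)
    \<comment> \<open>The isometry \<open>rot g\<close> carries the momentum in the frame of the
      second particle to the sum that \<open>C2\<close> measures.\<close>
    have "imq (rot g (right_mom \<mu>)) = imq (A1 + rot g A2)"
      using g(1) by (simp add: \<mu> right_mom_def imq_rot distrib_left distrib_right mult.assoc)
    then have "rot g (right_mom \<mu>) = A1 + rot g A2" by (simp only: imq_eq_iff)
    with g norm_rot[OF g(1), of "right_mom \<mu>"] show ?thesis by simp
  qed
  show "right_map z \<in> casimir_level ((norm \<nu>)\<^sup>2) \<and>
      (\<exists>k\<in>S3. z = right_lift k (right_map z) \<and> k * imq (right_mom (right_map z)) = \<nu> * k)"
    if "z \<in> level_set phase_space JR \<nu>" for z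
  proof -
    obtain g1 p1 g2 p2 where z: "z = (g1, p1, g2, p2)" by (cases z)
    with that have z': "g1 \<in> S3" "g2 \<in> S3" "qre (p1 * cnj_quat g1) = 0" "qre (p2 * cnj_quat g2) = 0"
      and J: "cnj_quat g1 * p1 + cnj_quat g2 * p2 = \<nu>"
      unfolding qre_mult_commute[of p1] qre_mult_commute[of p2]
      by (auto simp: level_set_phase_space phase_set_iff JR_def simp del: mem_sphere_0)
    have mom: "imq (right_mom (right_map z)) = g2 * \<nu> * cnj_quat g2"
      using z' by (simp add: z right_mom_def right_map_def imq_rot imq_qim J[symmetric] mult.assoc
          distrib_left distrib_right)
    have gR: "g1 * cnj_quat g2 \<in> S3" by (intro S3_closed z')
    \<comment> \<open>The sum measured by \<open>C2\<close> is \<nu> conjugated by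
      \<open>g1\<close>, whereas \<open>right_mom\<close> is \<nu> conjugated by
      \<open>g2\<close>.\<close>
    have "imq (qim (p1 * cnj_quat g1) + rot (g1 * cnj_quat g2) (qim (p2 * cnj_quat g2))) =
        g1 * \<nu> * cnj_quat g1"
      using z' by (simp add: imq_rot imq_qim J[symmetric] mult.assoc distrib_left distrib_right)
    then have "norm (qim (p1 * cnj_quat g1) + rot (g1 * cnj_quat g2) (qim (p2 * cnj_quat g2))) = norm \<nu>"
      using z' norm_imq by (metis mem_sphere_0 mult.right_neutral mult_1 norm_cnj norm_mult)
    then have "right_map z \<in> casimir_level ((norm \<nu>)\<^sup>2)"
      using gR by (simp add: z right_map_def casimir_level_iff)
    moreover have "z = right_lift (cnj_quat g2) (right_map z)"
      using z' by (simp add: z right_map_def right_lift_def imq_qim mult.assoc)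
    moreover have "cnj_quat g2 * imq (right_mom (right_map z)) = \<nu> * cnj_quat g2"
      unfolding mom using z' by (simp add: mult.assoc)
    ultimately show ?thesis using S3_closed(2)[OF z'(2)] by blast
  qed
  show "right_lift k \<mu> \<in> level_set phase_space JR \<nu> \<and> right_map (right_lift k \<mu>) = \<mu>"
    if k: "k \<in> S3" and \<mu>: "\<mu> \<in> casimir_level ((norm \<nu>)\<^sup>2)" and eq: "k * imq (right_mom \<mu>) = \<nu> * k" for k \<mu>
  proof -
    obtain A1 A2 g where [simp]: "\<mu> = (A1, A2, g)" by (cases \<mu>)
    have g: "g \<in> S3" using \<mu> by (simp add: casimir_level_iff)
    have gk: "g * cnj_quat k \<in> S3" "cnj_quat k \<in> S3" by (intro S3_closed k g)+
    have inv: "inverse (g * cnj_quat k) = k * cnj_quat g" "inverse (cnj_quat k) = k"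
      using S3_cnj(3)[OF gk(1)] S3_cnj(3)[OF gk(2)] by simp_all
    have "JR (right_lift k \<mu>) = k * imq (right_mom \<mu>) * cnj_quat k"
      using k by (simp add: JR_def right_lift_def right_mom_def inv imq_rot mult.assoc distrib_left distrib_right)
    then have "JR (right_lift k \<mu>) = \<nu>" unfolding eq using k by (simp add: mult.assoc)
    moreover have "right_lift k \<mu> \<in> phase_set"
      unfolding right_lift_def phase_set_iff qre_mult_commute[of "cnj_quat (snd (snd \<mu>) * cnj_quat k)"]
        qre_mult_commute[of "cnj_quat (cnj_quat k)"]
      using k gk g by (simp add: mult.assoc del: mem_sphere_0)
    moreover have "right_map (right_lift k \<mu>) = \<mu>"
      using k g by (simp add: right_lift_def right_map_def mult.assoc)
    ultimately show ?thesis by (simp add: level_set_phase_space)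
  qed
  show "right_act h (right_lift k \<mu>) = right_lift (h * k) \<mu>" if "h \<in> S3" for h k \<mu>
    using that by (simp add: right_lift_def mult.assoc)
  fix \<gamma> \<delta> assume \<gamma>: "smooth_curve (embedded (level_set phase_space JR \<nu>)) \<gamma>"
    and \<delta>: "smooth_curve (embedded (level_set phase_space JR \<nu>)) \<delta>" and eq: "\<gamma> 0 = \<delta> 0"
  obtain g1 p1 g2 p2 where z: "\<gamma> 0 = (g1, p1, g2, p2)" by (cases "\<gamma> 0")
  obtain A1 A2 g where \<mu>: "right_map (\<gamma> 0) = (A1, A2, g)" by (cases "right_map (\<gamma> 0)")
  have "\<gamma> 0 \<in> level_set phase_space JR \<nu>"
    using eventually_nhds_x_imp_x[OF eventually_smooth_curve[OF \<gamma>]] by simp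
  then have g12: "g1 \<in> S3" "g2 \<in> S3"
    using z by (auto simp: level_set_phase_space phase_set_iff)
  have g: "g \<in> S3" using \<mu> z S3_closed g12 by (auto simp: right_map_def norm_mult)
  from right_curve[OF \<gamma> z \<mu>] obtain x y b1 b2 where 1:
    "vector_derivative \<gamma> (at 0) = (- (imq x * g1), (imq b1 - imq x * imq A1) * g1,
        - (imq y * g2), (imq b2 - imq y * imq A2) * g2)"
    "imq b2 = - (cnj_quat g * imq b1 * g)"
    "vector_derivative (right_map \<circ> \<gamma>) (at 0) =
        (comm A1 x + b1, comm A2 y + b2, g * imq y - imq x * g)" by blast
  from right_curve[OF \<delta> z[unfolded eq] \<mu>[unfolded eq]] obtain x' y' b1' b2' where 2:
    "vector_derivative \<delta> (at 0) = (- (imq x' * g1), (imq b1' - imq x' * imq A1) * g1,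
        - (imq y' * g2), (imq b2' - imq y' * imq A2) * g2)"
    "imq b2' = - (cnj_quat g * imq b1' * g)"
    "vector_derivative (right_map \<circ> \<delta>) (at 0) =
        (comm A1 x' + b1', comm A2 y' + b2', g * imq y' - imq x' * g)" by blast
  \<comment> \<open>Both particle terms change sign, matching the factor \<open>-1\<close> of the
    orbit form.\<close>
  show "ext_deriv tautological (\<gamma> 0) (vector_derivative \<gamma> (at 0)) (vector_derivative \<delta> (at 0)) =
      kks_form (-1) (right_map (\<gamma> 0)) (vector_derivative (right_map \<circ> \<gamma>) (at 0)) (vector_derivative (right_map \<circ> \<delta>) (at 0))"
    unfolding \<mu> 1(3) 2(3) kks_form_orbit[OF g 1(2) 2(2)] ext_deriv_tautological 1(1) 2(1)
    using right_particle_form[OF g12(1), of b1 x A1 x' b1'] right_particle_form[OF g12(2), of b2 y A2 y' b2']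
    by simp
qed (rule \<nu>)

text \<open>On the level the trivialized momenta are imaginary and the group elements are units, so
  neither \<open>qim\<close> nor the conjugate alters the values.\<close>

lemma salg_to_quat_left_map:
  assumes "z \<in> level_set phase_space JL \<nu>"
  shows "salg_to_quat (left_map z) = (R1 z, R2 z, gL z)"
  using assms by (cases z) (auto simp: level_set_phase_space phase_set_iff left_map_def imq_qim)

lemma salg_to_quat_right_map:
  assumes "z \<in> level_set phase_space JR \<nu>"
  shows "salg_to_quat (right_map z) = (L1 z, L2 z, gR z)"
proof -
  obtain g1 p1 g2 p2 where z: "z = (g1, p1, g2, p2)" by (cases z)
  with assms have "g1 \<in> S3" "g2 \<in> S3" "qre (p1 * cnj_quat g1) = 0" "qre (p2 * cnj_quat g2) = 0"
    unfolding qre_mult_commute[of p1] qre_mult_commute[of p2]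
    by (auto simp: level_set_phase_space phase_set_iff)
  then show ?thesis by (simp add: z right_map_def imq_qim)
qed

theorem proposition2p2:
  fixes lam rho :: quat
  assumes lam: "qre lam = 0" and rho: "qre rho = 0"
  shows "(\<forall>\<sigma>\<in>{1, -1}. casimir \<sigma> C1 \<and> casimir \<sigma> C2) \<and>
    (coadjoint_orbit (casimir_level ((norm lam)\<^sup>2)) \<and>
     (\<exists>\<phi>. symplectomorphism (left_reduced lam)
            (orbit_space 1 (casimir_level ((norm lam)\<^sup>2))) \<phi> \<and>
          (\<forall>z\<in>level_set phase_space JL lam.
             salg_to_quat (\<phi> (left_proj lam z)) = (R1 z, R2 z, gL z)))) \<and>
    (coadjoint_orbit (casimir_level ((norm rho)\<^sup>2)) \<and>
     (\<exists>\<phi>. symplectomorphism (right_reduced rho)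
            (orbit_space (-1) (casimir_level ((norm rho)\<^sup>2))) \<phi> \<and>
          (\<forall>z\<in>level_set phase_space JR rho.
             salg_to_quat (\<phi> (right_proj rho z)) = (L1 z, L2 z, gR z)))) \<and>
    (\<forall>c>0. diffeomorphic (embedded (casimir_level c))
       (embedded (sphere (0 :: real^3) 1 \<times> (UNIV :: (real^3) set) \<times> S3))) \<and>
    diffeomorphic (embedded (casimir_level 0)) (embedded ((UNIV :: (real^3) set) \<times> S3))"
proof (intro conjI ballI allI impI)
  show "\<exists>\<phi>. symplectomorphism (left_reduced lam) (orbit_space 1 (casimir_level ((norm lam)\<^sup>2))) \<phi> \<and>
      (\<forall>z\<in>level_set phase_space JL lam. salg_to_quat (\<phi> (left_proj lam z)) = (R1 z, R2 z, gL z))"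
    using left_reduction[OF lam] salg_to_quat_left_map by (metis (no_types))
  show "\<exists>\<phi>. symplectomorphism (right_reduced rho) (orbit_space (-1) (casimir_level ((norm rho)\<^sup>2))) \<phi> \<and>
      (\<forall>z\<in>level_set phase_space JR rho. salg_to_quat (\<phi> (right_proj rho z)) = (L1 z, L2 z, gR z))"
    using right_reduction[OF rho] salg_to_quat_right_map by (metis (no_types))
qed (intro casimir_C1 casimir_C2 coadjoint_orbit_casimir_level zero_le_power2
    diffeomorphic_casimir_level_pos diffeomorphic_casimir_level_zero; assumption)+

end
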